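(* For every $n>6$, the fourth largest (distinct) eigenvalue of the Transposition graph $T_n$ is $\frac{n(n-5)}{2}$, and its multiplicity is $\left(\frac{(n-1)(n-2)}{2}\right)^2$.
   Context: The Transposition graph $T_n$ is the Cayley graph $\mathrm{Cay}(\mathrm{Sym}_n,T)$ on the symmetric group $\mathrm{Sym}_n$, where $T$ is the set of all transpositions. Eigenvalues and multiplicities refer to its adjacency matrix. *)

theory Defs
  imports
    "HOL-Algebra.Sym_Groups"
    "Graph_Theory.Pair_Digraph"
    "Jordan_Normal_Form.Char_Poly"
begin

text \<open>An undirected simple graph is a symmetric irreflexive set of arcs. The Cayley graph is of
  this kind when \<open>S\<close> is closed under inverses and does not contain the identity.\<close>

definition cayley_graph :: "('a, 'b) monoid_scheme \<Rightarrow> 'a set \<Rightarrow> 'a pair_pre_digraph" where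
  "cayley_graph G S =
    \<lparr> pverts = carrier G, parcs = {(x, x \<otimes>\<^bsub>G\<^esub> s) | x s. x \<in> carrier G \<and> s \<in> S} \<rparr>"

definition transpositions :: "nat \<Rightarrow> (nat \<Rightarrow> nat) set" where
  "transpositions n =
    {Transposition.transpose i j | i j. i \<in> {1..n} \<and> j \<in> {1..n} \<and> i \<noteq> j}"

definition transposition_graph :: "nat \<Rightarrow> (nat \<Rightarrow> nat) pair_pre_digraph" where
  "transposition_graph n = cayley_graph (sym_group n) (transpositions n)"

definition vertex_enumeration :: "'a pair_pre_digraph \<Rightarrow> 'a list \<Rightarrow> bool" where
  "vertex_enumeration G vs \<longleftrightarrow> distinct vs \<and> set vs = pverts G"

definition adjacency_matrix :: "'a pair_pre_digraph \<Rightarrow> 'a list \<Rightarrow> real mat" where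
  "adjacency_matrix G vs =
    mat (length vs) (length vs) (\<lambda>(i, j). if (vs ! i, vs ! j) \<in> parcs G then 1 else 0)"

definition is_kth_largest :: "nat \<Rightarrow> 'a::linorder set \<Rightarrow> 'a \<Rightarrow> bool" where
  "is_kth_largest k S x \<longleftrightarrow>
    x \<in> S \<and> finite {y \<in> S. x < y} \<and> Suc (card {y \<in> S. x < y}) = k"

definition eigenvalue_multiplicity :: "real mat \<Rightarrow> real \<Rightarrow> nat" where
  "eigenvalue_multiplicity A a = Polynomial.order a (char_poly A)"

lemma cayley_transposition_graph_symmetric: "sym (parcs (transposition_graph n))"
proof (rule symI)
  fix x y assume "(x, y) \<in> parcs (transposition_graph n)"
  then obtain i j where ij: "x permutes {1..n}" "i \<in> {1..n}" "j \<in> {1..n}" "i \<noteq> j"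
    "y = x \<circ> Transposition.transpose i j"
    by (auto simp: transposition_graph_def cayley_graph_def transpositions_def sym_group_def)
  have "y permutes {1..n}"
    unfolding ij(5) by (intro permutes_compose permutes_swap_id ij)
  moreover have "x = y \<circ> Transposition.transpose i j"
    unfolding ij(5) by (simp add: comp_assoc)
  ultimately show "(y, x) \<in> parcs (transposition_graph n)"
    using ij(2-4)
    unfolding transposition_graph_def cayley_graph_def transpositions_def sym_group_def
    by simp blast
qed

lemma transposition_graph_irreflexive: "(x, x) \<notin> parcs (transposition_graph n)"
proof
  assume "(x, x) \<in> parcs (transposition_graph n)"
  then obtain i j where ij: "x permutes {1..n}" "i \<noteq> j" "x = x \<circ> Transposition.transpose i j"
    by (auto simp: transposition_graph_def cayley_graph_def transpositions_def sym_group_def)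
  have "x i = x j" using fun_cong[OF ij(3), of i] by simp
  with ij(1,2) show False by (auto dest: permutes_inj injD)
qed

end

theory Submission
  imports Defs "HOL-Library.Function_Algebras"
begin

text \<open>
  The adjacency operator is the sum of the Jucys--Murphy operators \<open>J\<^sub>k = \<Sum>\<^bsub>i<k\<^esub> (i k)\<close>, acting by right
  translation on functions on the symmetric group. These commute and are self-adjoint. With the
  transposition \<open>s\<^sub>i = (i i+1)\<close>, the operator \<open>\<Phi>\<^sub>i = s\<^sub>i (J\<^sub>i - J\<^sub>i\<^sub>+\<^sub>1) + 1\<close> interchanges \<open>J\<^sub>i\<close> and \<open>J\<^sub>i\<^sub>+\<^sub>1\<close>, is
  skew-adjoint and satisfies \<open>\<Phi>\<^sub>i\<^sup>2 = 1 - (J\<^sub>i - J\<^sub>i\<^sub>+\<^sub>1)\<^sup>2\<close>. Hence a product of factors \<open>J\<^sub>i - c\<close> that vanishes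
  yields such a product for \<open>J\<^sub>i\<^sub>+\<^sub>1\<close>, so all \<open>J\<^sub>k\<close> are simultaneously diagonalisable; following Okounkov
  and Vershik, every tuple of joint eigenvalues is the content sequence of a standard tableau.

  An eigenvalue is therefore a sum of contents, and for \<open>n > 6\<close> the four largest sums belong to the
  shapes \<open>(n)\<close>, \<open>(n-1,1)\<close>, \<open>(n-2,2)\<close> and \<open>(n-2,1,1)\<close>. The last shape has \<open>(n-1 choose 2)\<close> tableaux, whose joint
  eigenspaces have the same dimension because the \<open>\<Phi>\<^sub>i\<close> map between them injectively. For the tableau
  with \<open>1, \<dots>, n-2\<close> in the first row, the joint eigenspace consists of the functions \<open>g (x (n-1)) (x n)\<close>
  with \<open>g\<close> skew-symmetric with vanishing row sums, so this dimension is again \<open>(n-1 choose 2)\<close>.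
\<close>

section \<open>Simultaneous diagonalisation of self-adjoint operators\<close>

definition shift_prod :: "('v \<Rightarrow> 'v) \<Rightarrow> real list \<Rightarrow> 'v \<Rightarrow> 'v::real_vector" where
  "shift_prod J cs x = foldr (\<lambda>c y. J y - c *\<^sub>R y) cs x"

lemma shift_prod_simps [simp]:
  "shift_prod J [] x = x"
  "shift_prod J (c # cs) x = J (shift_prod J cs x) - c *\<^sub>R shift_prod J cs x"
  by (simp_all add: shift_prod_def)

lemma shift_prod_append: "shift_prod J (cs @ ds) x = shift_prod J cs (shift_prod J ds x)"
  by (simp add: shift_prod_def)

lemma linear_shift_prod:
  assumes "linear J"
  shows "linear (shift_prod J cs)"
proof (induction cs)
  case (Cons c cs)
  then show ?case
    using assms by (auto simp: linear_iff algebra_simps)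
qed (simp add: linear_iff)

lemma shift_prod_eigenvector:
  assumes "linear J" "J x = c *\<^sub>R x"
  shows "shift_prod J cs x = (\<Prod>d\<leftarrow>cs. c - d) *\<^sub>R x"
  by (induction cs) (auto simp: assms linear_scale algebra_simps)

lemma shift_prod_eq_0_if_in_span_eigenvectors:
  assumes "linear J" "x \<in> span {y. \<exists>c\<in>set cs. J y = c *\<^sub>R y}"
  shows "shift_prod J cs x = 0"
proof (rule linear_eq_0_on_span[OF linear_shift_prod[OF assms(1)] _ assms(2)])
  fix y assume "y \<in> {y. \<exists>c\<in>set cs. J y = c *\<^sub>R y}"
  then obtain c where "c \<in> set cs" "J y = c *\<^sub>R y" by blast
  then show "shift_prod J cs y = 0"
    using shift_prod_eigenvector[OF assms(1), of y c cs] by auto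
qed

lemma shift_prod_intertwine:
  assumes "linear K" "\<And>x. K (J x) = J' (K x)"
  shows "K (shift_prod J cs x) = shift_prod J' cs (K x)"
  by (induction cs) (auto simp: assms linear_diff linear_scale)

lemma shift_prod_mem:
  assumes "subspace W" "\<And>x. x \<in> W \<Longrightarrow> J x \<in> W" "x \<in> W"
  shows "shift_prod J cs x \<in> W"
  by (induction cs) (auto simp: assms subspace_diff subspace_scale)

definition joint_eigenspace :: "'v set \<Rightarrow> ('k \<Rightarrow> 'v \<Rightarrow> 'v) \<Rightarrow> 'k set \<Rightarrow> ('k \<Rightarrow> real) \<Rightarrow> 'v::real_vector set" where
  "joint_eigenspace V J K a = {x \<in> V. \<forall>k\<in>K. J k x = a k *\<^sub>R x}"

lemma joint_eigenspace_cong: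
  "(\<And>k. k \<in> K \<Longrightarrow> a k = b k) \<Longrightarrow> joint_eigenspace V J K a = joint_eigenspace V J K b"
  by (auto simp: joint_eigenspace_def)

lemma subspace_joint_eigenspace:
  assumes "subspace V" "\<And>k. k \<in> K \<Longrightarrow> linear (J k)"
  shows "subspace (joint_eigenspace V J K a)"
  using assms by (auto simp: subspace_def joint_eigenspace_def linear_0 linear_add linear_scale algebra_simps)

locale inner_product_on =
  fixes V :: "'v::real_vector set" and ip :: "'v \<Rightarrow> 'v \<Rightarrow> real"
  assumes subspace: "subspace V"
    and linear_left: "linear (\<lambda>x. ip x y)"
    and commute: "ip x y = ip y x"
    and positive: "\<lbrakk>x \<in> V; x \<noteq> 0\<rbrakk> \<Longrightarrow> 0 < ip x x"
begin

lemma linear_right: "linear (ip x)"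
  using linear_left[of x] by (simp add: commute[of _ x])

lemmas ip_simps =
  linear_0[OF linear_left] linear_add[OF linear_left] linear_diff[OF linear_left]
  linear_neg[OF linear_left] linear_scale[OF linear_left] linear_sum[OF linear_left]
  linear_0[OF linear_right] linear_add[OF linear_right] linear_diff[OF linear_right]
  linear_neg[OF linear_right] linear_scale[OF linear_right] linear_sum[OF linear_right]

lemma ip_self_nonneg: "x \<in> V \<Longrightarrow> 0 \<le> ip x x"
  using positive[of x] linear_0[OF linear_left, of x] by (cases "x = 0") auto

lemma ip_self_eq_0: "x \<in> V \<Longrightarrow> ip x x = 0 \<Longrightarrow> x = 0"
  using positive[of x] by fastforce

definition self_adjoint_on :: "'v set \<Rightarrow> ('v \<Rightarrow> 'v) \<Rightarrow> bool" where
  "self_adjoint_on W J \<longleftrightarrow> (\<forall>x\<in>W. \<forall>y\<in>W. ip (J x) y = ip x (J y))"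

lemma self_adjoint_onD: "self_adjoint_on W J \<Longrightarrow> x \<in> W \<Longrightarrow> y \<in> W \<Longrightarrow> ip (J x) y = ip x (J y)"
  by (simp add: self_adjoint_on_def)

lemma self_adjoint_on_subset: "self_adjoint_on W J \<Longrightarrow> U \<subseteq> W \<Longrightarrow> self_adjoint_on U J"
  by (auto simp: self_adjoint_on_def)

lemma self_adjoint_on_shift_prod:
  assumes "linear J" "subspace W" "\<And>x. x \<in> W \<Longrightarrow> J x \<in> W" and sa: "self_adjoint_on W J"
  shows "self_adjoint_on W (shift_prod J cs)"
proof (induction cs)
  case (Cons c cs)
  show ?case
    unfolding self_adjoint_on_def
  proof (intro ballI)
    fix x y assume xy: "x \<in> W" "y \<in> W"
    let ?K = "\<lambda>z. J z - c *\<^sub>R z"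
    have mem: "shift_prod J cs x \<in> W" "?K y \<in> W"
      using assms xy by (auto intro: shift_prod_mem subspace_diff subspace_scale)
    have "ip (shift_prod J (c # cs) x) y = ip (shift_prod J cs x) (?K y)"
      using self_adjoint_onD[OF sa mem(1) xy(2)] by (simp add: ip_simps)
    also have "\<dots> = ip x (shift_prod J cs (?K y))"
      using Cons xy mem by (simp add: self_adjoint_on_def)
    also have "shift_prod J cs (?K y) = shift_prod J (c # cs) y"
      using linear_shift_prod[OF assms(1), of cs] shift_prod_intertwine[OF assms(1), of J J cs y]
      by (simp add: linear_diff linear_scale)
    finally show "ip (shift_prod J (c # cs) x) y = ip x (shift_prod J (c # cs) y)" .
  qed
qed (simp add: self_adjoint_on_def)

lemma eigenvector_shift_prod_eq_0:
  assumes J: "linear J" and W: "subspace W" "W \<subseteq> V" "\<And>y. y \<in> W \<Longrightarrow> J y \<in> W"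
    and sa: "self_adjoint_on W J" and "x \<in> W" "c \<in> set cs"
    and eigen: "J (shift_prod J cs x) = c *\<^sub>R shift_prod J cs x"
  shows "shift_prod J cs x = 0"
proof -
  let ?h = "shift_prod J cs x"
  have h: "?h \<in> W" using W(1,3) \<open>x \<in> W\<close> by (rule shift_prod_mem)
  have "ip ?h ?h = ip (shift_prod J cs ?h) x"
    using self_adjoint_onD[OF self_adjoint_on_shift_prod[OF J W(1,3) sa] h \<open>x \<in> W\<close>] by simp
  also have "shift_prod J cs ?h = 0"
    using shift_prod_eigenvector[OF J eigen, of cs] \<open>c \<in> set cs\<close> by auto
  finally show ?thesis
    using ip_self_eq_0 h W(2) by (auto simp: ip_simps)
qed

lemma in_span_eigenvectors_if_shift_prod_eq_0:
  assumes J: "linear J" and W: "subspace W" "W \<subseteq> V" "\<And>y. y \<in> W \<Longrightarrow> J y \<in> W"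
    and sa: "self_adjoint_on W J" and "x \<in> W" "shift_prod J cs x = 0"
  shows "x \<in> span {y \<in> W. \<exists>c\<in>set cs. J y = c *\<^sub>R y}"
  using \<open>x \<in> W\<close> \<open>shift_prod J cs x = 0\<close>
proof (induction cs arbitrary: x)
  case (Cons c cs)
  let ?E = "\<lambda>cs. {y \<in> W. \<exists>c\<in>set cs. J y = c *\<^sub>R y}" and ?h = "shift_prod J cs x"
  let ?r = "\<Prod>d\<leftarrow>cs. c - d"
  have h: "?h \<in> W" "J ?h = c *\<^sub>R ?h"
    using Cons.prems shift_prod_mem[OF W(1,3)] by auto
  have mono: "span (?E cs) \<subseteq> span (?E (c # cs))"
    by (intro span_mono) auto
  show ?case
  proof (cases "c \<in> set cs")
    case True
    have "?h = 0"
      by (rule eigenvector_shift_prod_eq_0[OF J W sa Cons.prems(1) True h(2)])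
    then show ?thesis
      using Cons.IH Cons.prems(1) mono by blast
  next
    case False
    then have "?r \<noteq> 0" by auto
    let ?x = "x - (1 / ?r) *\<^sub>R ?h"
    have "shift_prod J cs ?x = 0"
      using linear_shift_prod[OF J, of cs] shift_prod_eigenvector[OF J h(2), of cs] \<open>?r \<noteq> 0\<close>
      by (simp add: linear_diff linear_scale)
    moreover have "?x \<in> W"
      using Cons.prems(1) h(1) W(1) by (simp add: subspace_diff subspace_scale)
    ultimately have "?x \<in> span (?E (c # cs))"
      using Cons.IH mono by blast
    moreover have "(1 / ?r) *\<^sub>R ?h \<in> span (?E (c # cs))"
      using h by (intro span_scale span_base) auto
    ultimately have "?x + (1 / ?r) *\<^sub>R ?h \<in> span (?E (c # cs))"
      by (rule span_add)
    then show ?thesis by simp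
  qed
qed (simp add: span_zero)

lemma joint_eigenspace_subset_span_insert:
  assumes "k \<notin> K" and J: "\<And>l. l \<in> insert k K \<Longrightarrow> linear (J l)"
    and inv: "\<And>x. x \<in> V \<Longrightarrow> J k x \<in> V" and sa: "self_adjoint_on V (J k)"
    and comm: "\<And>l x. l \<in> K \<Longrightarrow> J l (J k x) = J k (J l x)"
    and killed: "\<And>x. x \<in> V \<Longrightarrow> shift_prod (J k) cs x = 0"
  shows "joint_eigenspace V J K a \<subseteq> span (\<Union>b. joint_eigenspace V J (insert k K) b)"
proof
  let ?W = "joint_eigenspace V J K a"
  fix x assume x: "x \<in> ?W"
  have WV: "?W \<subseteq> V" by (auto simp: joint_eigenspace_def)
  have "x \<in> span {y \<in> ?W. \<exists>c\<in>set cs. J k y = c *\<^sub>R y}"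
  proof (rule in_span_eigenvectors_if_shift_prod_eq_0[OF _ _ WV])
    show "subspace ?W"
      using J by (intro subspace_joint_eigenspace subspace) auto
    show "J k y \<in> ?W" if "y \<in> ?W" for y
      using that comm inv J[of k] by (simp add: joint_eigenspace_def linear_scale)
    show "self_adjoint_on ?W (J k)"
      using sa WV by (rule self_adjoint_on_subset)
  qed (use J x WV killed in auto)
  moreover have "{y \<in> ?W. \<exists>c\<in>set cs. J k y = c *\<^sub>R y} \<subseteq> (\<Union>b. joint_eigenspace V J (insert k K) b)"
  proof clarify
    fix y c assume "y \<in> ?W" "J k y = c *\<^sub>R y"
    then have "y \<in> joint_eigenspace V J (insert k K) (a(k := c))"
      using assms(1) by (auto simp: joint_eigenspace_def)
    then show "y \<in> (\<Union>b. joint_eigenspace V J (insert k K) b)" by blast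
  qed
  ultimately show "x \<in> span (\<Union>b. joint_eigenspace V J (insert k K) b)"
    using span_mono by blast
qed

lemma subset_span_joint_eigenspaces:
  assumes "finite K" and "\<And>k. k \<in> K \<Longrightarrow> linear (J k)"
    and "\<And>k x. k \<in> K \<Longrightarrow> x \<in> V \<Longrightarrow> J k x \<in> V"
    and "\<And>k. k \<in> K \<Longrightarrow> self_adjoint_on V (J k)"
    and "\<And>k l x. k \<in> K \<Longrightarrow> l \<in> K \<Longrightarrow> J k (J l x) = J l (J k x)"
    and "\<And>k. k \<in> K \<Longrightarrow> \<exists>cs. \<forall>x\<in>V. shift_prod (J k) cs x = 0"
  shows "V \<subseteq> span (\<Union>a. joint_eigenspace V J K a)"
  using assms
proof (induction K rule: finite_induct)
  case empty
  show ?case by (simp add: joint_eigenspace_def span_superset)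
next
  case (insert k K)
  let ?E = "\<lambda>K. \<Union>a. joint_eigenspace V J K a"
  obtain cs where "\<And>x. x \<in> V \<Longrightarrow> shift_prod (J k) cs x = 0"
    using insert.prems(5) by blast
  with insert.hyps(2) insert.prems have "joint_eigenspace V J K a \<subseteq> span (?E (insert k K))" for a
    by (intro joint_eigenspace_subset_span_insert[of k K J cs]) auto
  then have "span (?E K) \<subseteq> span (?E (insert k K))"
    by (intro span_minimal) auto
  moreover have "V \<subseteq> span (?E K)"
    using insert by simp
  ultimately show ?case by blast
qed

lemma joint_eigenspace_orthogonal:
  assumes "x \<in> joint_eigenspace V J K a" "y \<in> joint_eigenspace V J K b"
    and "k \<in> K" "a k \<noteq> b k" "self_adjoint_on V (J k)"
  shows "ip x y = 0"
proof -
  have "a k * ip x y = b k * ip x y"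
    using self_adjoint_onD[OF assms(5), of x y] assms(1-3) by (simp add: joint_eigenspace_def ip_simps)
  then show ?thesis using assms(4) by simp
qed

lemma in_span_Int_if_orthogonal:
  assumes "finite B" "subspace W" "W \<subseteq> V" "x \<in> W" "x \<in> span B"
    and orth: "\<And>b y. b \<in> B - W \<Longrightarrow> y \<in> W \<Longrightarrow> ip b y = 0"
  shows "x \<in> span (B \<inter> W)"
proof -
  obtain u where u: "x = (\<Sum>b\<in>B. u b *\<^sub>R b)"
    using assms(1,5) by (auto simp: span_finite)
  let ?y = "\<Sum>b\<in>B \<inter> W. u b *\<^sub>R b" and ?z = "\<Sum>b\<in>B - W. u b *\<^sub>R b"
  have "x - ?y = ?z"
    unfolding u using sum.Int_Diff[OF assms(1), of "\<lambda>b. u b *\<^sub>R b" W] by simp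
  moreover have z: "x - ?y \<in> W"
    using assms(2,4) by (intro subspace_diff subspace_sum subspace_scale) auto
  moreover have "ip ?z (x - ?y) = 0"
    using orth[OF _ z] by (simp add: ip_simps(5,6))
  ultimately have "x - ?y = 0"
    using assms(3) by (intro ip_self_eq_0) auto
  moreover have "?y \<in> span (B \<inter> W)"
    by (intro span_sum span_scale span_base)
  ultimately show ?thesis by simp
qed

lemma card_basis_Int_joint_eigenspace:
  assumes J: "\<And>k. k \<in> K \<Longrightarrow> linear (J k)" and sa: "\<And>k. k \<in> K \<Longrightarrow> self_adjoint_on V (J k)"
    and B: "finite B" "independent B" "V \<subseteq> span B" "B \<subseteq> (\<Union>a. joint_eigenspace V J K a)"
  shows "card (B \<inter> joint_eigenspace V J K a) = dim (joint_eigenspace V J K a)"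
proof (rule basis_card_eq_dim)
  let ?W = "joint_eigenspace V J K a"
  have WV: "?W \<subseteq> V" by (auto simp: joint_eigenspace_def)
  show "independent (B \<inter> ?W)"
    using B(2) by (rule independent_mono) blast
  show "?W \<subseteq> span (B \<inter> ?W)"
  proof
    fix x assume x: "x \<in> ?W"
    show "x \<in> span (B \<inter> ?W)"
    proof (rule in_span_Int_if_orthogonal[OF B(1) _ WV x])
      show "subspace ?W"
        using J by (intro subspace_joint_eigenspace subspace)
      show "x \<in> span B" using x WV B(3) by blast
      fix b y assume b: "b \<in> B - ?W" and y: "y \<in> ?W"
      obtain c where c: "b \<in> joint_eigenspace V J K c" using b B(4) by blast
      then obtain k where "k \<in> K" "c k \<noteq> a k"
        using b joint_eigenspace_cong[of K c a] by blast
      then show "ip b y = 0"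
        using joint_eigenspace_orthogonal[OF c y] sa by blast
    qed
  qed
qed simp

lemma joint_eigenbasis_exists:
  assumes "finite F" "V \<subseteq> span F" and J: "\<And>k. k \<in> K \<Longrightarrow> linear (J k)"
    and sa: "\<And>k. k \<in> K \<Longrightarrow> self_adjoint_on V (J k)"
    and spanned: "V \<subseteq> span (\<Union>a. joint_eigenspace V J K a)"
  obtains B where "finite B" "independent B" "B \<subseteq> (\<Union>a. joint_eigenspace V J K a)" "card B = dim V"
    "\<And>a. card (B \<inter> joint_eigenspace V J K a) = dim (joint_eigenspace V J K a)"
proof -
  let ?E = "\<Union>a. joint_eigenspace V J K a"
  obtain B where B: "B \<subseteq> ?E" "independent B" "?E \<subseteq> span B"
    by (rule maximal_independent_subset)
  have span: "V \<subseteq> span B"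
    using spanned span_minimal[OF B(3) subspace_span] by blast
  have BV: "B \<subseteq> V" using B(1) by (auto simp: joint_eigenspace_def)
  then have fin: "finite B"
    using independent_span_bound[OF assms(1) B(2)] assms(2) by blast
  show ?thesis
    using that[OF fin B(2,1) basis_card_eq_dim[OF BV span B(2)]]
      card_basis_Int_joint_eigenspace[OF J sa fin B(2) span B(1)] by blast
qed

end

lemma dim_le_if_inj_on:
  assumes "linear \<phi>" "subspace U" and ker: "\<And>x. x \<in> U \<Longrightarrow> \<phi> x = 0 \<Longrightarrow> x = 0"
    and img: "\<phi> ` U \<subseteq> W" and "finite F" "W \<subseteq> span F"
  shows "dim U \<le> dim W"
proof -
  have inj: "inj_on \<phi> U"
    using linear_inj_on_iff_eq_0[OF assms(1,2)] ker by blast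
  obtain B where B: "B \<subseteq> U" "independent B" "U \<subseteq> span B" "card B = dim U"
    by (rule basis_exists)
  obtain C where C: "C \<subseteq> W" "independent C" "W \<subseteq> span C" "card C = dim W"
    by (rule basis_exists)
  have "span B = U"
    using B(1,3) assms(2) span_minimal by blast
  then have "independent (\<phi> ` B)"
    using linear_independent_injective_image[OF assms(1) B(2)] inj by simp
  moreover have "finite C"
    using independent_span_bound[OF assms(5) C(2)] C(1) assms(6) by blast
  moreover have "\<phi> ` B \<subseteq> span C"
    using B(1) C(3) img by blast
  ultimately have "card (\<phi> ` B) \<le> card C"
    using independent_span_bound by blast
  moreover have "card (\<phi> ` B) = card B"
    using inj B(1) by (intro card_image) (rule inj_on_subset)
  ultimately show ?thesis using B(4) C(4) by simp
qed

lemma dim_eq_0_iff_if_subset_span: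
  assumes "finite F" "V \<subseteq> span F"
  shows "dim V = 0 \<longleftrightarrow> V \<subseteq> {0}"
proof
  assume "dim V = 0"
  obtain B where B: "B \<subseteq> V" "independent B" "V \<subseteq> span B" "card B = dim V"
    by (rule basis_exists)
  then have "finite B" using independent_span_bound[OF assms(1) B(2)] assms(2) by blast
  then have "B = {}" using B(4) \<open>dim V = 0\<close> by simp
  then show "V \<subseteq> {0}" using B(3) by simp
next
  assume "V \<subseteq> {0}"
  then show "dim V = 0" using dim_le_card[of V "{}"] by simp
qed

section \<open>Real-valued functions\<close>

instantiation "fun" :: (type, real_vector) real_vector
begin

definition scaleR_fun_def: "c *\<^sub>R f = (\<lambda>x. c *\<^sub>R f x)"

instance
  by standard (auto simp: scaleR_fun_def fun_eq_iff algebra_simps)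

end

lemma scaleR_fun_apply [simp]: "(c *\<^sub>R f) x = c *\<^sub>R f x"
  by (simp add: scaleR_fun_def)

lemma sum_fun_apply: "(\<Sum>i\<in>A. f i) x = (\<Sum>i\<in>A. f i x)"
  by (induction A rule: infinite_finite_induct) auto

definition supported_on :: "'a set \<Rightarrow> ('a \<Rightarrow> real) set" where
  "supported_on G = {f. \<forall>x. x \<notin> G \<longrightarrow> f x = 0}"

lemma subspace_supported_on: "subspace (supported_on G)"
  by (auto simp: subspace_def supported_on_def)

definition inner_on :: "'a set \<Rightarrow> ('a \<Rightarrow> real) \<Rightarrow> ('a \<Rightarrow> real) \<Rightarrow> real" where
  "inner_on G f g = (\<Sum>x\<in>G. f x * g x)"

lemma inner_product_on_inner_on:
  assumes "finite G"
  shows "inner_product_on (supported_on G) (inner_on G)"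
proof (rule inner_product_on.intro)
  show "subspace (supported_on G)" by (rule subspace_supported_on)
  fix f g :: "'a \<Rightarrow> real"
  show "linear (\<lambda>f. inner_on G f g)"
    by (auto simp: linear_iff inner_on_def sum.distrib sum_distrib_left algebra_simps)
  show "inner_on G f g = inner_on G g f"
    by (simp add: inner_on_def mult.commute)
next
  fix f :: "'a \<Rightarrow> real"
  assume f: "f \<in> supported_on G" "f \<noteq> 0"
  then obtain x where "f x \<noteq> 0" by (auto simp: fun_eq_iff)
  then show "0 < inner_on G f f"
    unfolding inner_on_def using assms f(1)
    by (intro sum_pos2[of G x]) (auto simp: supported_on_def zero_less_mult_iff linorder_neq_iff)
qed

lemma dual_family_eval:
  fixes F :: "'i \<Rightarrow> 'a \<Rightarrow> real"
  assumes "finite I" and dual: "\<And>i j. i \<in> I \<Longrightarrow> j \<in> I \<Longrightarrow> F i (pt j) = of_bool (i = j)" and "j \<in> I"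
  shows "(\<Sum>i\<in>I. u i *\<^sub>R F i) (pt j) = u j"
proof -
  have "(\<Sum>i\<in>I. u i * F i (pt j)) = (\<Sum>i\<in>I. if i = j then u i else 0)"
    using dual \<open>j \<in> I\<close> by (intro sum.cong) auto
  then show ?thesis using assms(1,3) by (simp add: sum_fun_apply)
qed

lemma dual_family_independent:
  fixes F :: "'i \<Rightarrow> 'a \<Rightarrow> real"
  assumes "finite I" and dual: "\<And>i j. i \<in> I \<Longrightarrow> j \<in> I \<Longrightarrow> F i (pt j) = of_bool (i = j)"
  shows "inj_on F I" "independent (F ` I)"
proof -
  show inj: "inj_on F I"
  proof (rule inj_onI)
    fix i j assume "i \<in> I" "j \<in> I" "F i = F j"
    then have "of_bool (i = j) = (1 :: real)"
      using dual[of i j] dual[of j j] by simp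
    then show "i = j" by (simp split: if_splits)
  qed
  show "independent (F ` I)"
  proof (rule independent_if_scalars_zero)
    fix u g assume "(\<Sum>g\<in>F ` I. u g *\<^sub>R g) = 0" and "g \<in> F ` I"
    then obtain i where "i \<in> I" "g = F i" "(\<Sum>i\<in>I. u (F i) *\<^sub>R F i) = 0"
      by (auto simp: sum.reindex[OF inj])
    then show "u g = 0" using dual_family_eval[of I F pt, OF assms, of i "\<lambda>i. u (F i)"] by simp
  qed (use assms(1) in simp)
qed

lemma dual_family_basis:
  fixes F :: "'i \<Rightarrow> 'a \<Rightarrow> real"
  assumes "finite I" "subspace W" "F ` I \<subseteq> W"
    and dual: "\<And>i j. i \<in> I \<Longrightarrow> j \<in> I \<Longrightarrow> F i (pt j) = of_bool (i = j)"
    and determined: "\<And>f. f \<in> W \<Longrightarrow> (\<And>i. i \<in> I \<Longrightarrow> f (pt i) = 0) \<Longrightarrow> f = 0"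
  shows "W \<subseteq> span (F ` I)" "dim W = card I"
proof -
  show span: "W \<subseteq> span (F ` I)"
  proof
    fix f assume f: "f \<in> W"
    let ?g = "\<Sum>i\<in>I. f (pt i) *\<^sub>R F i"
    have "f - ?g = 0"
      using f assms(2,3) dual_family_eval[of I F pt, OF assms(1) dual]
      by (intro determined) (auto intro!: subspace_diff subspace_sum subspace_scale)
    moreover have "?g \<in> span (F ` I)"
      by (intro span_sum span_scale span_base) auto
    ultimately show "f \<in> span (F ` I)" by simp
  qed
  show "dim W = card I"
    using basis_card_eq_dim[OF assms(3) span] dual_family_independent[of I F pt, OF assms(1) dual]
    by (simp add: card_image)
qed

definition unit_fun :: "'a \<Rightarrow> 'a \<Rightarrow> real" where
  "unit_fun x = (\<lambda>y. of_bool (y = x))"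

lemma supported_on_unit_fun_basis:
  assumes "finite G"
  shows "supported_on G \<subseteq> span (unit_fun ` G)" "dim (supported_on G) = card G"
proof -
  have sub: "unit_fun ` G \<subseteq> supported_on G"
    by (auto simp: unit_fun_def supported_on_def)
  have dual: "unit_fun x (id y) = of_bool (x = y)" for x y :: 'a
    by (auto simp: unit_fun_def)
  have determined: "f = 0" if "f \<in> supported_on G" "\<And>x. x \<in> G \<Longrightarrow> f (id x) = 0" for f
    using that by (auto simp: supported_on_def fun_eq_iff)
  show "supported_on G \<subseteq> span (unit_fun ` G)" "dim (supported_on G) = card G"
    using dual_family_basis[OF assms subspace_supported_on sub dual determined] by blast+
qed

section \<open>Content sequences\<close>

text \<open>The conditions of Okounkov and Vershik for \<open>a i\<close> to be the content (column minus row) of the box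
  with entry \<open>i\<close> in a standard tableau with \<open>n\<close> boxes.\<close>

locale content_seq =
  fixes n :: nat and a :: "nat \<Rightarrow> real"
  assumes n_pos: "0 < n"
    and start: "a 1 = 0"
    and neighbour_before: "q \<in> {2..n} \<Longrightarrow> \<exists>r\<in>{1..<q}. \<bar>a r - a q\<bar> = 1"
    and succ_between: "\<lbrakk>1 \<le> p; p < q; q \<le> n; a p = a q\<rbrakk> \<Longrightarrow> \<exists>r\<in>{p<..<q}. a r = a p + 1"
    and pred_between: "\<lbrakk>1 \<le> p; p < q; q \<le> n; a p = a q\<rbrakk> \<Longrightarrow> \<exists>r\<in>{p<..<q}. a r = a p - 1"

locale content_family =
  fixes n :: nat and C :: "(nat \<Rightarrow> real) set"
  assumes n_pos: "0 < n"
    and start: "a \<in> C \<Longrightarrow> a 1 = 0"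
    and adjacent: "\<lbrakk>a \<in> C; 1 \<le> i; i < n\<rbrakk> \<Longrightarrow> a i \<noteq> a (Suc i)"
    and swap: "\<lbrakk>a \<in> C; 1 \<le> i; i < n; \<bar>a i - a (Suc i)\<bar> \<noteq> 1\<rbrakk> \<Longrightarrow> a \<circ> transpose i (Suc i) \<in> C"
    and braid: "\<lbrakk>a \<in> C; 1 \<le> i; Suc i < n; \<bar>a i - a (Suc i)\<bar> = 1\<rbrakk> \<Longrightarrow> a (Suc (Suc i)) \<noteq> a i"
begin

lemma neighbour_before:
  assumes "a \<in> C" "q \<in> {2..n}"
  shows "\<exists>r\<in>{1..<q}. \<bar>a r - a q\<bar> = 1"
  using assms
proof (induction q arbitrary: a)
  case (Suc q)
  show ?case
  proof (cases "\<bar>a q - a (Suc q)\<bar> = 1")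
    case True
    then show ?thesis using Suc.prems by (intro bexI[of _ q]) auto
  next
    case False
    let ?b = "a \<circ> transpose q (Suc q)"
    have b: "?b \<in> C" using swap Suc.prems False by auto
    have "q \<noteq> 1"
    proof
      assume "q = 1"
      then have "a 1 = a (Suc 1)" using start[OF b] start[OF Suc.prems(1)] by simp
      then show False using adjacent[OF Suc.prems(1), of 1] Suc.prems(2) \<open>q = 1\<close> by simp
    qed
    then obtain r where r: "r \<in> {1..<q}" "\<bar>?b r - ?b q\<bar> = 1"
      using Suc.IH[OF b] Suc.prems by auto
    then have "\<bar>a r - a (Suc q)\<bar> = 1" by (simp add: transpose_def)
    then show ?thesis using r by (intro bexI[of _ r]) auto
  qed
qed simp

lemma succ_between_if_swap_right:
  assumes a: "a \<in> C" "1 \<le> m" "m < n" "\<bar>a m - a (Suc m)\<bar> \<noteq> 1" "p < m" "a p = a (Suc m)"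
    and shorter: "\<And>b. \<lbrakk>b \<in> C; b p = b m\<rbrakk> \<Longrightarrow> \<exists>r\<in>{p<..<m}. b r = b p + 1"
  shows "\<exists>r\<in>{p<..<Suc m}. a r = a p + 1"
proof -
  let ?b = "a \<circ> transpose m (Suc m)"
  have eq: "?b r = a r" if "r < m" for r
    using that by simp
  have "?b p = ?b m" using a(5,6) by simp
  then obtain r where "r \<in> {p<..<m}" "?b r = ?b p + 1"
    using shorter swap[OF a(1-4)] by blast
  then show ?thesis using eq[of r] eq[of p] a(5) by (intro bexI[of _ r]) auto
qed

lemma succ_between_if_swap_left:
  assumes a: "a \<in> C" "1 \<le> p" "p < n" "\<bar>a p - a (Suc p)\<bar> \<noteq> 1" "Suc p < q" "a p = a q"
    and shorter: "\<And>b. \<lbrakk>b \<in> C; b (Suc p) = b q\<rbrakk> \<Longrightarrow> \<exists>r\<in>{Suc p<..<q}. b r = b (Suc p) + 1"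
  shows "\<exists>r\<in>{p<..<q}. a r = a p + 1"
proof -
  let ?b = "a \<circ> transpose p (Suc p)"
  have eq: "?b r = a r" if "Suc p < r" for r
    using that by simp
  have "?b (Suc p) = ?b q" using a(5,6) by simp
  then obtain r where "r \<in> {Suc p<..<q}" "?b r = ?b (Suc p) + 1"
    using shorter swap[OF a(1-4)] by blast
  then show ?thesis using eq[of r] by (intro bexI[of _ r]) auto
qed

text \<open>Swapping an end of the interval with its inner neighbour shortens the interval, unless their
  values differ by one.\<close>

lemma succ_between:
  assumes "a \<in> C" "1 \<le> p" "p < q" "q \<le> n" "a p = a q"
  shows "\<exists>r\<in>{p<..<q}. a r = a p + 1"
  using assms
proof (induction "q - p" arbitrary: a p q rule: less_induct)
  case less
  have IH: "\<exists>r\<in>{p'<..<q'}. b r = b p' + 1"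
    if "b \<in> C" "p \<le> p'" "q' \<le> q" "p < p' \<or> q' < q" "p' < q'" "b p' = b q'" for b p' q'
    using that less.prems by (intro less.hyps) auto
  obtain m where m: "q = Suc m" using less.prems(3) by (cases q) auto
  have "p \<noteq> m"
    using adjacent[OF less.prems(1), of p] less.prems m by auto
  then have "p < m" using less.prems(3) m by simp
  consider (right) "\<bar>a m - a q\<bar> \<noteq> 1" | (left) "\<bar>a p - a (Suc p)\<bar> \<noteq> 1"
    | (found) "a (Suc p) = a p + 1 \<or> a m = a p + 1"
    | (both) "\<bar>a p - a (Suc p)\<bar> = 1" "a (Suc p) = a p - 1" "a m = a p - 1"
    using less.prems(5) by fastforce
  then show ?case
  proof cases
    case right
    show ?thesis
      unfolding m by (rule succ_between_if_swap_right)
        (use less.prems right m \<open>p < m\<close> IH[of _ p m] in auto)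
  next
    case left
    show ?thesis
      by (rule succ_between_if_swap_left)
        (use less.prems left m \<open>p < m\<close> IH[of _ "Suc p" q] in auto)
  next
    case found
    then show ?thesis using \<open>p < m\<close> m less.prems(5) by auto
  next
    case both
    have "Suc p \<noteq> m"
      using braid[OF less.prems(1), of p] less.prems both(1) m by auto
    then obtain r where r: "r \<in> {Suc p<..<m}" "a r = a p"
      using IH[OF less.prems(1), of "Suc p" m] both \<open>p < m\<close> m by auto
    then have "\<exists>s\<in>{p<..<r}. a s = a p + 1"
      using m by (intro IH less.prems(1)) auto
    then show ?thesis using r m by fastforce
  qed
qed

lemma content_family_uminus: "content_family n ((\<lambda>a i. - a i) ` C)"
proof unfold_locales
  fix b assume "b \<in> (\<lambda>a i. - a i) ` C"
  then obtain a where a: "a \<in> C" "b = (\<lambda>i. - a i)" by blast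
  show "b 1 = 0" using start[OF a(1)] a(2) by simp
  fix i :: nat assume "1 \<le> i"
  show "b i \<noteq> b (Suc i)" if "i < n"
    using adjacent[OF a(1) \<open>1 \<le> i\<close> that] a(2) by simp
  show "b \<circ> transpose i (Suc i) \<in> (\<lambda>a i. - a i) ` C" if "i < n" "\<bar>b i - b (Suc i)\<bar> \<noteq> 1"
    using swap[OF a(1) \<open>1 \<le> i\<close> that(1)] that(2) a(2)
    by (intro image_eqI[of _ _ "a \<circ> transpose i (Suc i)"]) (auto simp: abs_minus_commute)
  show "b (Suc (Suc i)) \<noteq> b i" if "Suc i < n" "\<bar>b i - b (Suc i)\<bar> = 1"
    using braid[OF a(1) \<open>1 \<le> i\<close> that(1)] that(2) a(2) by (auto simp: abs_minus_commute)
qed (rule n_pos)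

lemma pred_between:
  assumes "a \<in> C" "1 \<le> p" "p < q" "q \<le> n" "a p = a q"
  shows "\<exists>r\<in>{p<..<q}. a r = a p - 1"
proof -
  have "(\<lambda>i. - a i) \<in> (\<lambda>a i. - a i) ` C" using assms(1) by (rule imageI)
  from content_family.succ_between[OF content_family_uminus this assms(2-4)]
  obtain r where "r \<in> {p<..<q}" "- a r = - a p + 1" using assms(5) by auto
  then show ?thesis by (intro bexI[of _ r]) auto
qed

lemma content_seq: "a \<in> C \<Longrightarrow> content_seq n a"
  by (intro content_seq.intro n_pos start neighbour_before succ_between pred_between)

end

definition content_mult :: "nat \<Rightarrow> (nat \<Rightarrow> real) \<Rightarrow> real \<Rightarrow> nat" where
  "content_mult n a c = card {i\<in>{1..n}. a i = c}"

lemma content_mult_uminus: "content_mult n (\<lambda>i. - a i) c = content_mult n a (- c)"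
  unfolding content_mult_def by (rule arg_cong[where f = card]) auto

context content_seq
begin

lemma content_seq_uminus: "content_seq n (\<lambda>i. - a i)"
proof
  fix p q :: nat assume "1 \<le> p" "p < q" "q \<le> n" "- a p = - a q"
  then obtain r s where "r \<in> {p<..<q}" "a r = a p - 1" "s \<in> {p<..<q}" "a s = a p + 1"
    using pred_between[of p q] succ_between[of p q] by auto
  then show "\<exists>r\<in>{p<..<q}. - a r = - a p + 1" "\<exists>r\<in>{p<..<q}. - a r = - a p - 1"
    by (auto intro: bexI[of _ r] bexI[of _ s])
qed (use n_pos start neighbour_before in \<open>auto simp: abs_minus_commute\<close>)

lemma content_in_Ints: "q \<in> {1..n} \<Longrightarrow> a q \<in> \<int>"
proof (induction q rule: less_induct)
  case (less q)
  show ?case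
  proof (cases "q = 1")
    case True
    then show ?thesis using start by simp
  next
    case False
    then obtain r where r: "r \<in> {1..<q}" "\<bar>a r - a q\<bar> = 1"
      using neighbour_before[of q] less.prems by auto
    then have "a q = a r + 1 \<or> a q = a r - 1" by linarith
    moreover have "a r \<in> \<int>" using less r by auto
    ultimately show ?thesis by auto
  qed
qed

lemma pred_before:
  assumes "q \<in> {1..n}" "a q > 0"
  shows "\<exists>r\<in>{1..<q}. a r = a q - 1"
  using assms
proof (induction q rule: less_induct)
  case (less q)
  have "q \<noteq> 1" using less.prems start by auto
  then obtain r where r: "r \<in> {1..<q}" "\<bar>a r - a q\<bar> = 1"
    using neighbour_before[of q] less.prems by auto
  then consider "a r = a q - 1" | "a r = a q + 1" by linarith
  then show ?case
  proof cases
    case 2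
    then obtain r' where r': "r' \<in> {1..<r}" "a r' = a q"
      using less.IH[of r] r less.prems by auto
    then obtain r'' where "r'' \<in> {1..<r'}" "a r'' = a q - 1"
      using less.IH[of r'] r less.prems by auto
    then show ?thesis using r r' by auto
  qed (use r in blast)
qed

lemma smaller_before:
  assumes "q \<in> {1..n}" "a q = real l" "k < l"
  shows "\<exists>r\<in>{1..<q}. a r = real k"
  using assms
proof (induction l arbitrary: q)
  case (Suc l)
  then obtain r where r: "r \<in> {1..<q}" "a r = real l"
    using pred_before[of q] by auto
  show ?case
  proof (cases "k = l")
    case False
    then obtain s where "s \<in> {1..<r}" "a s = real k"
      using Suc.IH[of r] Suc.prems r by auto
    then show ?thesis using r(1) by auto
  qed (use r in blast)
qed simp

lemma less_if_eq_real:
  assumes "q \<in> {1..n}" "a q = real k"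
  shows "k < q"
proof -
  have "\<exists>r. r \<in> {1..q} \<and> a r = real j" if "j \<in> {..k}" for j
    using smaller_before[OF assms, of j] assms that by (cases "j = k") force+
  then obtain f where f: "f j \<in> {1..q}" "a (f j) = real j" if "j \<in> {..k}" for j
    by metis
  have "inj_on f {..k}"
    by (rule inj_onI) (metis f(2) of_nat_eq_iff)
  then have "card {..k} \<le> card {1..q}"
    using f(1) by (intro card_inj_on_le) auto
  then show ?thesis by simp
qed

lemma nonneg_contentE:
  assumes "q \<in> {1..n}" "0 \<le> a q"
  obtains k where "k < q" "a q = real k"
proof -
  obtain z where z: "a q = of_int z" using content_in_Ints[OF assms(1)] by (rule Ints_cases)
  then have "a q = real (nat z)" using assms(2) by simp
  then show ?thesis using that less_if_eq_real[OF assms(1)] by blast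
qed

lemma content_cases:
  assumes "q \<in> {1..n}"
  obtains (nonneg) k where "k < n" "a q = real k" | (neg) k where "k < n" "a q = - real (Suc k)"
proof (cases "0 \<le> a q")
  case True
  then obtain k where "k < q" "a q = real k" by (rule nonneg_contentE[OF assms])
  then show ?thesis using assms nonneg by simp
next
  case False
  then obtain k where "k < q" "- a q = real k"
    using content_seq.nonneg_contentE[OF content_seq_uminus assms] by auto
  moreover from this have "a q = - real (Suc (k - 1))" using False by simp
  ultimately show ?thesis using assms by (intro neg[of "k - 1"]) auto
qed

lemma content_mult_pos: "q \<in> {1..n} \<Longrightarrow> 0 < content_mult n a (a q)"
  unfolding content_mult_def by (subst card_gt_0_iff) auto

lemma card_le_content_mult_pred:
  assumes S: "S \<subseteq> {i\<in>{1..n}. a i = c}"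
    and before: "\<And>q. q \<in> S \<Longrightarrow> \<exists>r\<in>{1..<q}. a r = c - 1"
  shows "card S \<le> content_mult n a (c - 1)"
proof -
  define g where "g q = Max {r\<in>{1..<q}. a r = c - 1}" for q
  have g: "g q \<in> {r\<in>{1..<q}. a r = c - 1}" if "q \<in> S" for q
    unfolding g_def using before[OF that] by (intro Max_in) auto
  have less: "g p < g q" if pq: "p \<in> S" "q \<in> S" "p < q" for p q
  proof -
    have "1 \<le> p" "q \<le> n" "a p = a q" "a p = c" using pq S by auto
    then obtain r where r: "r \<in> {p<..<q}" "a r = c - 1"
      using pred_between[of p q] pq by auto
    then have "r \<le> g q" unfolding g_def by (intro Max_ge) auto
    moreover have "g p < p" using g[OF pq(1)] by auto
    ultimately show ?thesis using r by auto
  qed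
  have "inj_on g S"
    by (rule linorder_inj_onI') (use less in force)
  moreover have "g ` S \<subseteq> {i\<in>{1..n}. a i = c - 1}"
    using g S by fastforce
  ultimately show ?thesis
    unfolding content_mult_def by (intro card_inj_on_le) auto
qed

lemma content_mult_le_pred:
  assumes "c > 0"
  shows "content_mult n a c \<le> content_mult n a (c - 1)"
  using card_le_content_mult_pred[OF order.refl, of c] pred_before assms
  unfolding content_mult_def by auto

lemma content_mult_le_Suc_pred: "content_mult n a c \<le> Suc (content_mult n a (c - 1))"
proof (cases "{i\<in>{1..n}. a i = c} = {}")
  case False
  let ?S = "{i\<in>{1..n}. a i = c}"
  let ?m = "Min ?S"
  have fin: "finite ?S" by simp
  have m: "?m \<in> ?S" by (rule Min_in[OF fin False])
  have "card (?S - {?m}) \<le> content_mult n a (c - 1)"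
  proof (rule card_le_content_mult_pred)
    fix q assume q: "q \<in> ?S - {?m}"
    then have "?m \<le> q" "?m \<noteq> q"
      using Min_le[OF fin, of q] by blast+
    moreover have "a ?m = a q" "1 \<le> ?m" "q \<le> n" "a ?m = c"
      using q m by auto
    ultimately obtain r where "r \<in> {?m<..<q}" "a r = c - 1"
      using pred_between[of ?m q] by auto
    then show "\<exists>r\<in>{1..<q}. a r = c - 1" by (intro bexI[of _ r]) auto
  qed auto
  then show ?thesis
    using m fin unfolding content_mult_def by (simp add: card_Diff_singleton)
qed (unfold content_mult_def, metis card.empty le0)

lemma sum_contents:
  fixes h :: "real \<Rightarrow> real"
  shows "(\<Sum>i=1..n. h (a i)) = (\<Sum>c<n. real (content_mult n a (real c)) * h (real c))
    + (\<Sum>c<n. real (content_mult n a (- real (Suc c))) * h (- real (Suc c)))"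
proof -
  let ?P = "real ` {..<n}" and ?N = "(\<lambda>c. - real (Suc c)) ` {..<n}"
  have "a ` {1..n} \<subseteq> ?P \<union> ?N"
  proof
    fix x assume "x \<in> a ` {1..n}"
    then obtain i where "i \<in> {1..n}" "x = a i" by blast
    then show "x \<in> ?P \<union> ?N" by (cases rule: content_cases[of i]) auto
  qed
  then have "(\<Sum>i=1..n. h (a i)) = (\<Sum>c\<in>?P \<union> ?N. \<Sum>i\<in>{i\<in>{1..n}. a i = c}. h (a i))"
    by (intro sum.group[symmetric]) auto
  also have "\<dots> = (\<Sum>c\<in>?P \<union> ?N. real (content_mult n a c) * h c)"
    unfolding content_mult_def by (intro sum.cong) auto
  also have "\<dots> = (\<Sum>c\<in>?P. real (content_mult n a c) * h c) + (\<Sum>c\<in>?N. real (content_mult n a c) * h c)"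
  proof (rule sum.union_disjoint)
    have "real c \<noteq> - real (Suc d)" for c d by (simp add: add_eq_0_iff2)
    then show "?P \<inter> ?N = {}" by auto
  qed auto
  finally show ?thesis
    by (simp add: sum.reindex inj_on_def)
qed

end

section \<open>The four largest content sums\<close>

lemma sum_real_lessThan: "(\<Sum>c<k. real c) = real k * (real k - 1) / 2"
  by (induction k) (auto simp: field_simps)

lemma antimono_weighted_sum_le:
  fixes u :: "nat \<Rightarrow> nat"
  assumes "antimono u"
  shows "2 * (\<Sum>c<k. c * u c) \<le> (k - 1) * (\<Sum>c<k. u c)"
proof (cases "k = 0")
  case False
  have "k * (\<Sum>c=0..<k. c * u c) \<le> (\<Sum>c=0..<k. c) * (\<Sum>c=0..<k. u c)"
    by (rule Chebyshev_sum_upper_nat) (use antimonoD[OF assms] in auto)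
  then have "2 * (k * (\<Sum>c<k. c * u c)) \<le> (2 * (\<Sum>c<k. c)) * (\<Sum>c<k. u c)"
    by (simp add: lessThan_atLeast0)
  moreover have "2 * (\<Sum>c<k. c) = k * (k - 1)" for k :: nat
    by (induction k) (auto simp: algebra_simps)
  ultimately have "k * (2 * (\<Sum>c<k. c * u c)) \<le> k * ((k - 1) * (\<Sum>c<k. u c))"
    by (simp add: algebra_simps)
  then show ?thesis using False by (simp only: mult_le_cancel1)
qed simp

text \<open>For a Young diagram with \<open>n\<close> boxes, \<open>K\<close> is the length of the first row, \<open>e c\<close> is the number of boxes
  of content \<open>c\<close> outside of it, and \<open>w c\<close> is the number of boxes of content \<open>-(c+1)\<close>.\<close>

locale diagonal_lengths =
  fixes n K :: nat and e w :: "nat \<Rightarrow> nat"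
  assumes antimono_e: "antimono e" and antimono_w: "antimono w"
    and e_le_w: "e 0 \<le> w 0" and w_le_Suc_e: "w 0 \<le> Suc (e 0)"
    and e_eq_0: "K \<le> c \<Longrightarrow> e c = 0"
    and K_pos: "0 < K"
    and size: "K + (\<Sum>c<n. e c) + (\<Sum>c<n. w c) = n"
begin

abbreviation excess_count :: nat where "excess_count \<equiv> \<Sum>c<n. e c"

abbreviation excess_total :: nat where "excess_total \<equiv> \<Sum>c<n. c * e c"

abbreviation negative_count :: nat where "negative_count \<equiv> \<Sum>c<n. w c"

abbreviation negative_total :: nat where "negative_total \<equiv> \<Sum>c<n. Suc c * w c"

definition content_total :: real where
  "content_total = real K * (real K - 1) / 2 + real excess_total - real negative_total"

lemma K_le: "K \<le> n"
  using size by simp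

lemma excess_total_le: "2 * excess_total \<le> (K - 1) * excess_count"
proof -
  have "(\<Sum>c<n. f c * e c) = (\<Sum>c<K. f c * e c)" for f
    using K_le e_eq_0 by (intro sum.mono_neutral_right) auto
  from this[of "\<lambda>c. c"] this[of "\<lambda>_. 1"] show ?thesis
    using antimono_weighted_sum_le[OF antimono_e, of K] by simp
qed

lemma excess_total_le_choose: "2 * excess_total \<le> (excess_count - 1) * excess_count"
proof -
  have "e c = 0" if "excess_count \<le> c" "c < n" for c
  proof (rule ccontr)
    assume "e c \<noteq> 0"
    then have "1 \<le> e d" if "d \<le> c" for d
      using antimonoD[OF antimono_e that] by simp
    then have "(\<Sum>d<Suc c. 1) \<le> (\<Sum>d<Suc c. e d)"
      by (intro sum_mono) auto
    also have "\<dots> \<le> excess_count" using that by (intro sum_mono2) auto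
    finally show False using that by simp
  qed
  then have "(\<Sum>c<n. f c * e c) = (\<Sum>c<excess_count. f c * e c)" for f
    using size by (intro sum.mono_neutral_right) auto
  from this[of "\<lambda>c. c"] this[of "\<lambda>_. 1"] show ?thesis
    using antimono_weighted_sum_le[OF antimono_e, of excess_count] by simp
qed

lemma negative_count_le_total: "negative_count \<le> negative_total"
  by (intro sum_mono) simp

lemma w_pos:
  assumes "K < n"
  shows "0 < w 0"
proof (rule ccontr)
  assume "\<not> 0 < w 0"
  then have "w c = 0" "e c = 0" for c
    using antimonoD[OF antimono_w, of 0 c] antimonoD[OF antimono_e, of 0 c] e_le_w by auto
  then show False using size assms by simp
qed

lemma negative_count_pos:
  assumes "K < n"
  shows "0 < negative_count"
  using w_pos[OF assms] assms by (intro sum_pos2[of _ 0]) auto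

lemma negative_sums_if_count_le_2:
  assumes "3 \<le> n" "negative_count \<le> 2"
  shows "w 2 = 0" "negative_count = w 0 + w 1" "negative_total = w 0 + 2 * w 1"
proof -
  have "(\<Sum>c<3. w c) \<le> negative_count"
    using assms(1) by (intro sum_mono2) auto
  moreover have "w 2 \<le> w 1" "w 1 \<le> w 0"
    using antimonoD[OF antimono_w] by auto
  ultimately show "w 2 = 0"
    using assms(2) by (simp add: eval_nat_numeral)
  then have "w c = 0" if "2 \<le> c" for c
    using antimonoD[OF antimono_w that] by simp
  then have "(\<Sum>c<n. f c * w c) = (\<Sum>c<2. f c * w c)" for f
    using assms(1) by (intro sum.mono_neutral_right) auto
  from this[of "\<lambda>_. 1"] this[of Suc]
  show "negative_count = w 0 + w 1" "negative_total = w 0 + 2 * w 1"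
    by (simp_all add: eval_nat_numeral)
qed

lemma content_total_row:
  assumes "K = n"
  shows "content_total = real n * (real n - 1) / 2"
proof -
  have excess_total: "excess_total = 0" and negative_total: "negative_total = 0"
    using size assms by auto
  show ?thesis
    unfolding content_total_def excess_total negative_total by (simp add: assms)
qed

lemma content_total_near_row:
  assumes "Suc K = n" "3 \<le> n"
  shows "content_total = real n * (real n - 3) / 2"
proof -
  have "K < n" using assms(1) by simp
  have excess_count: "excess_count = 0" and negative_count: "negative_count = 1"
    using size negative_count_pos[OF \<open>K < n\<close>] assms(1) by linarith+
  have excess_total: "excess_total = 0"
    using excess_total_le_choose excess_count by simp
  have "w 0 = 1" "w 1 = 0"
    using negative_sums_if_count_le_2(2)[OF assms(2)] negative_count w_pos[OF \<open>K < n\<close>] by linarith+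
  then have negative_total: "negative_total = 1"
    using negative_sums_if_count_le_2(3)[OF assms(2)] negative_count by simp
  have row: "real K = real n - 1" using assms(1) by linarith
  show ?thesis
    unfolding content_total_def excess_total negative_total row by (simp add: field_simps)
qed

lemma content_total_second_row_or_hook:
  assumes "K + 2 = n" "3 \<le> n"
  shows "content_total = (real n - 1) * (real n - 4) / 2
    \<or> content_total = real n * (real n - 5) / 2 \<and> e 0 = 0 \<and> w 0 = 1 \<and> w 1 = 1 \<and> w 2 = 0"
proof -
  have "excess_count + negative_count = 2" "0 < negative_count"
    using size negative_count_pos assms(1) by linarith+
  then have negative_count: "negative_count \<le> 2" and "excess_count \<le> 1" by simp_all
  have row: "real K = real n - 2" using assms(1) by linarith
  have excess_total: "excess_total = 0"
    using excess_total_le_choose \<open>excess_count \<le> 1\<close> by (cases "excess_count = 0") auto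
  note negative_sums = negative_sums_if_count_le_2[OF assms(2) negative_count]
  have "0 < w 0" using w_pos assms(1) by simp
  consider "excess_count = 1" "negative_count = 1" | "excess_count = 0" "negative_count = 2"
    using \<open>excess_count + negative_count = 2\<close> \<open>0 < negative_count\<close> by linarith
  then show ?thesis
  proof cases
    case 1
    then have "w 0 = 1" "w 1 = 0" using negative_sums(2) \<open>0 < w 0\<close> by auto
    then have "content_total = (real n - 1) * (real n - 4) / 2"
      unfolding content_total_def excess_total negative_sums(3) row by (simp add: field_simps)
    then show ?thesis ..
  next
    case 2
    then have "e 0 = 0" using assms(2) by auto
    then have "w 0 = 1" using w_le_Suc_e \<open>0 < w 0\<close> by simp
    moreover from this have "w 1 = 1" using negative_sums(2) 2 by simp
    ultimately have "content_total = real n * (real n - 5) / 2"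
      unfolding content_total_def excess_total negative_sums(3) row by (simp add: field_simps)
    then show ?thesis using \<open>e 0 = 0\<close> \<open>w 0 = 1\<close> \<open>w 1 = 1\<close> negative_sums(1) by simp
  qed
qed

lemma content_total_short_row:
  assumes "K + 3 \<le> n" "6 < n"
  shows "content_total < real n * (real n - 5) / 2"
proof -
  have "0 < negative_count" using negative_count_pos assms(1) by simp
  then have negative_total: "1 \<le> real negative_total" using negative_count_le_total by linarith
  show ?thesis
  proof (cases "K + 3 = n")
    case True
    then have "excess_count \<le> 2" using size \<open>0 < negative_count\<close> by linarith
    then have "(excess_count - 1) * excess_count \<le> 1 * 2" by (intro mult_le_mono) auto
    then have "real excess_total \<le> 1" using excess_total_le_choose by linarith
    then have "content_total \<le> real K * (real K - 1) / 2"
      using negative_total by (simp add: content_total_def)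
    also have "\<dots> < real n * (real n - 5) / 2"
      using assms(2) by (simp add: field_simps flip: True)
    finally show ?thesis .
  next
    case False
    have "real (2 * excess_total) \<le> real ((K - 1) * excess_count)"
      using excess_total_le by (simp only: of_nat_le_iff)
    then have "2 * content_total \<le> (real K - 1) * (real K + real excess_count) - 2"
      using negative_total K_pos by (simp add: content_total_def field_simps)
    also have "(real K - 1) * (real K + real excess_count) \<le> (real n - 5) * real n"
    proof (rule mult_mono)
      show "real K - 1 \<le> real n - 5" using assms(1) False by linarith
      show "real K + real excess_count \<le> real n" using size by linarith
    qed (use assms(2) in \<open>auto intro!: add_nonneg_nonneg sum_nonneg\<close>)
    finally show ?thesis by (simp add: mult.commute)
  qed
qed

lemma content_total_cases:
  assumes "6 < n"
  obtains "content_total = real n * (real n - 1) / 2" | "content_total = real n * (real n - 3) / 2"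
    | "content_total = (real n - 1) * (real n - 4) / 2"
    | "content_total = real n * (real n - 5) / 2" "e 0 = 0" "w 0 = 1" "w 1 = 1" "w 2 = 0"
    | "content_total < real n * (real n - 5) / 2"
proof -
  obtain m where m: "n = K + m" using K_le by (rule le_Suc_ex[THEN exE])
  consider "m = 0" | "m = 1" | "m = 2" | "3 \<le> m" by linarith
  then show ?thesis
    using that content_total_row content_total_near_row content_total_second_row_or_hook
      content_total_short_row assms m by cases auto
qed

end

section \<open>Classification of content sums\<close>

text \<open>Contents of the tableau of shape \<open>(n-2,1,1)\<close> with first column \<open>1, p, q\<close>.\<close>

definition hook_content :: "nat \<Rightarrow> nat \<Rightarrow> nat \<Rightarrow> real" where
  "hook_content p q i = (if i = p then -1 else if i = q then -2
     else real i - 1 - of_bool (p < i) - of_bool (q < i))"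

lemma hook_content_eq_card:
  assumes "2 \<le> p" "p < q" "1 \<le> i" "i \<noteq> p" "i \<noteq> q"
  shows "hook_content p q i = real (card ({1..<i} - {p, q}))"
proof -
  have "{p, q} \<inter> {1..<i} = (if p < i then {p} else {}) \<union> (if q < i then {q} else {})"
    using assms by auto
  then have "card ({1..<i} - {p, q}) = i - 1 - (of_bool (p < i) + of_bool (q < i))"
    using assms by (simp add: card_Diff_subset_Int Int_commute)
  then show ?thesis
    using assms by (simp add: hook_content_def split: if_splits)
qed

definition two_point_weight :: "nat \<Rightarrow> real \<Rightarrow> real \<Rightarrow> nat \<Rightarrow> real" where
  "two_point_weight n \<alpha> \<beta> k = (if k = n then \<beta> else if k = n - 1 then \<alpha> else real k - 1)"

lemma sum_two_point_weight:
  assumes "2 \<le> n"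
  shows "(\<Sum>k=1..n. two_point_weight n \<alpha> \<beta> k) = (real n - 2) * (real n - 3) / 2 + \<alpha> + \<beta>"
proof -
  obtain m where m: "n = Suc (Suc m)" using assms by (metis add_2_eq_Suc le_Suc_ex)
  have "(\<Sum>k=1..m. two_point_weight n \<alpha> \<beta> k) = (\<Sum>k=1..m. real k - 1)"
    by (intro sum.cong) (auto simp: two_point_weight_def m)
  then show ?thesis by (simp add: m two_point_weight_def sum.atLeast1_atMost_eq sum_real_lessThan)
qed

lemma hook_content_last:
  "2 \<le> n \<Longrightarrow> k \<in> {1..n} \<Longrightarrow> hook_content (n - 1) n k = two_point_weight n (-1) (-2) k"
  by (auto simp: hook_content_def two_point_weight_def)

context content_seq
begin

lemma antimono_content_mult_nonneg: "antimono (\<lambda>c. content_mult n a (real c))"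
  using content_mult_le_pred[of "real (Suc c)" for c] by (simp add: antimono_iff_le_Suc)

lemma antimono_content_mult_neg: "antimono (\<lambda>c. content_mult n a (- real (Suc c)))"
  using content_seq.content_mult_le_pred[OF content_seq_uminus, of "real (Suc (Suc c))" for c]
  by (simp add: antimono_iff_le_Suc content_mult_uminus)

definition row_length :: nat where
  "row_length = (LEAST k. content_mult n a (real k) = 0)"

definition excess :: "nat \<Rightarrow> nat" where
  "excess c = content_mult n a (real c) - 1"

definition leg :: "nat \<Rightarrow> nat" where
  "leg c = content_mult n a (- real (Suc c))"

lemma content_mult_zero_pos: "0 < content_mult n a 0"
  using content_mult_pos[of 1] start n_pos by simp

lemma content_mult_n: "content_mult n a (real n) = 0"
proof -
  have "a i \<noteq> real n" if "i \<in> {1..n}" for i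
    using less_if_eq_real[OF that, of n] that by auto
  then show ?thesis by (auto simp: content_mult_def)
qed

lemma row_length_le: "row_length \<le> n"
  unfolding row_length_def using content_mult_n by (rule Least_le)

lemma content_mult_row_length: "content_mult n a (real row_length) = 0"
  unfolding row_length_def by (rule LeastI, rule content_mult_n)

lemma content_mult_nonneg_eq: "content_mult n a (real c) = excess c + of_bool (c < row_length)"
proof (cases "c < row_length")
  case True
  then have "content_mult n a (real c) \<noteq> 0"
    unfolding row_length_def by (rule not_less_Least)
  then show ?thesis using True by (simp add: excess_def)
next
  case False
  then show ?thesis
    using content_mult_row_length antimonoD[OF antimono_content_mult_nonneg, of row_length c]
    by (simp add: excess_def)
qed

lemma sum_contents_by_row:
  fixes h :: "real \<Rightarrow> real"
  shows "(\<Sum>i=1..n. h (a i)) = (\<Sum>c<row_length. h (real c)) + (\<Sum>c<n. real (excess c) * h (real c))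
    + (\<Sum>c<n. real (leg c) * h (- real (Suc c)))"
proof -
  have "(\<Sum>c<n. of_bool (c < row_length) * h (real c)) = (\<Sum>c<row_length. h (real c))"
    by (rule sum.mono_neutral_cong_right) (use row_length_le in auto)
  then show ?thesis
    using sum_contents[of h, unfolded content_mult_nonneg_eq, folded leg_def]
    by (simp only: of_nat_add of_nat_of_bool distrib_right sum.distrib add_ac)
qed

sublocale diagonal_lengths n row_length excess leg
proof
  show "antimono excess"
    using antimonoD[OF antimono_content_mult_nonneg] by (auto simp: excess_def intro!: antimonoI diff_le_mono)
  show "antimono leg"
    using antimono_content_mult_neg by (simp add: leg_def[abs_def])
  show "leg 0 \<le> Suc (excess 0)"
    using content_seq.content_mult_le_pred[OF content_seq_uminus, of 1] content_mult_zero_pos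
    by (simp add: leg_def excess_def content_mult_uminus)
  show "excess 0 \<le> leg 0"
    using content_mult_le_Suc_pred[of 0] by (simp add: leg_def excess_def)
  show "0 < row_length"
    using content_mult_zero_pos content_mult_nonneg_eq[of 0] by (cases row_length) (auto simp: excess_def)
  show "excess c = 0" if "row_length \<le> c" for c
    using content_mult_nonneg_eq[of c] that by (simp add: excess_def)
  have "real n = real (row_length + (\<Sum>c<n. excess c) + (\<Sum>c<n. leg c))"
    using sum_contents_by_row[of "\<lambda>_. 1"] by simp
  then show "row_length + (\<Sum>c<n. excess c) + (\<Sum>c<n. leg c) = n" by linarith
qed

lemma sum_contents_eq_content_total: "(\<Sum>i=1..n. a i) = content_total"
  using sum_contents_by_row[of "\<lambda>x. x"]
  by (simp add: content_total_def sum_real_lessThan sum_subtractf sum.distrib sum_negf algebra_simps)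

lemma nonneg_content_eq_card:
  assumes inj: "inj_on a {j\<in>{1..n}. 0 \<le> a j}" and i: "i \<in> {1..n}" "0 \<le> a i"
  shows "a i = real (card {j\<in>{1..<i}. 0 \<le> a j})"
proof -
  let ?J = "{j\<in>{1..<i}. 0 \<le> a j}"
  obtain l where l: "a i = real l" by (rule nonneg_contentE[OF i])
  have "a ` ?J = real ` {..<l}"
  proof (intro equalityI subsetI)
    fix x assume "x \<in> a ` ?J"
    then obtain j where j: "j \<in> {1..<i}" "0 \<le> a j" "x = a j" by auto
    obtain k where k: "a j = real k" by (rule nonneg_contentE[of j]) (use i(1) j in auto)
    have unique: "r = i" if "r \<in> {1..j}" "a r = a i" for r
      using inj_onD[OF inj that(2)] that i j by auto
    have "\<not> l < k" using smaller_before[of j k l] unique l k i j by force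
    moreover have "k \<noteq> l" using unique[of j] l k j by auto
    ultimately show "x \<in> real ` {..<l}" using j(3) k by auto
  next
    fix x assume "x \<in> real ` {..<l}"
    then obtain k where k: "k < l" "x = real k" by auto
    then obtain j where "j \<in> {1..<i}" "a j = real k" using smaller_before[OF i(1) l] by blast
    then show "x \<in> a ` ?J" using k by (intro image_eqI[of _ _ j]) auto
  qed
  then have "card (a ` ?J) = l" by (simp add: card_image)
  moreover have "inj_on a ?J" using i by (intro inj_on_subset[OF inj]) auto
  ultimately show ?thesis using l by (simp add: card_image)
qed

lemma inj_on_nonneg_contents:
  assumes "content_mult n a 0 \<le> 1"
  shows "inj_on a {j\<in>{1..n}. 0 \<le> a j}"
proof (rule inj_onI)
  fix i j assume ij: "i \<in> {j\<in>{1..n}. 0 \<le> a j}" "j \<in> {j\<in>{1..n}. 0 \<le> a j}" "a i = a j"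
  obtain c where "a i = real c" by (rule nonneg_contentE[of i]) (use ij in auto)
  then have "card {k\<in>{1..n}. a k = a i} \<le> 1"
    using antimonoD[OF antimono_content_mult_nonneg, of 0 c] assms by (simp add: content_mult_def)
  then show "i = j" using ij by (auto simp: card_le_Suc0_iff_eq)
qed

lemma content_ge_if_mult_eq_0:
  assumes "content_mult n a (- real (Suc m)) = 0" "i \<in> {1..n}"
  shows "- real m \<le> a i"
proof (cases rule: content_cases[OF assms(2)])
  case (2 c)
  then have "\<not> m \<le> c"
    using antimonoD[OF antimono_content_mult_neg, of m c] content_mult_pos[OF assms(2)] assms(1) by auto
  then show ?thesis using 2 by simp
qed simp

lemma hook_content_if_mult:
  assumes "content_mult n a 0 \<le> 1" "content_mult n a (-1) = 1" "content_mult n a (-2) = 1"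
    "content_mult n a (-3) = 0"
  obtains p q where "2 \<le> p" "p < q" "q \<le> n" "\<And>i. i \<in> {1..n} \<Longrightarrow> a i = hook_content p q i"
proof -
  obtain p where p: "{i\<in>{1..n}. a i = -1} = {p}"
    using assms(2) unfolding content_mult_def by (rule card_1_singletonE)
  obtain q where q: "{i\<in>{1..n}. a i = -2} = {q}"
    using assms(3) unfolding content_mult_def by (rule card_1_singletonE)
  have p': "p \<in> {1..n}" "a p = -1" and q': "q \<in> {1..n}" "a q = -2" using p q by blast+
  have "p \<noteq> 1" using start p'(2) by auto
  then have "2 \<le> p" using p'(1) by auto
  obtain r where r: "r \<in> {1..<q}" "a r = -1"
    using content_seq.pred_before[OF content_seq_uminus, of q] q' by auto
  then have "r \<in> {i\<in>{1..n}. a i = -1}" using q' by auto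
  then have "r = p" using p by blast
  then have "p < q" using r(1) by simp
  have nonneg: "0 \<le> a i" if i: "i \<in> {1..n}" "i \<noteq> p" "i \<noteq> q" for i
  proof (cases rule: content_cases[OF i(1)])
    case (2 c)
    have "-2 \<le> a i" using content_ge_if_mult_eq_0[of 2 i] assms(4) i(1) by simp
    then have "c = 0 \<or> c = 1" using 2 by auto
    then have "i \<in> {p} \<union> {q}" unfolding p[symmetric] q[symmetric] using 2 i(1) by auto
    then show ?thesis using i by simp
  qed simp
  have "a i = hook_content p q i" if i: "i \<in> {1..n}" for i
  proof (cases "i = p \<or> i = q")
    case False
    have "{j\<in>{1..<i}. 0 \<le> a j} = {1..<i} - {p, q}"
      using nonneg p'(2) q'(2) i by force
    then have "a i = real (card ({1..<i} - {p, q}))"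
      using nonneg_content_eq_card[OF inj_on_nonneg_contents[OF assms(1)] i] nonneg[OF i] False by simp
    then show ?thesis
      using hook_content_eq_card[of p q i] False i \<open>2 \<le> p\<close> \<open>p < q\<close> by simp
  qed (use p' q' \<open>p < q\<close> in \<open>auto simp: hook_content_def\<close>)
  then show ?thesis using that \<open>2 \<le> p\<close> \<open>p < q\<close> q' by auto
qed

lemma content_sum_cases:
  assumes "6 < n"
  obtains "(\<Sum>i=1..n. a i) \<in>
        {real n * (real n - 1) / 2, real n * (real n - 3) / 2, (real n - 1) * (real n - 4) / 2}"
    | p q where "(\<Sum>i=1..n. a i) = real n * (real n - 5) / 2" "2 \<le> p" "p < q" "q \<le> n"
        "\<And>i. i \<in> {1..n} \<Longrightarrow> a i = hook_content p q i"
    | "(\<Sum>i=1..n. a i) < real n * (real n - 5) / 2"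
proof (cases rule: content_total_cases[OF assms, folded sum_contents_eq_content_total])
  case 4
  have "content_mult n a 0 \<le> 1" "content_mult n a (-1) = 1" "content_mult n a (-2) = 1"
    "content_mult n a (-3) = 0"
    using 4 by (simp_all add: excess_def leg_def)
  from hook_content_if_mult[OF this] obtain p q
    where pq: "2 \<le> p" "p < q" "q \<le> n" "\<And>i. i \<in> {1..n} \<Longrightarrow> a i = hook_content p q i" by blast
  show ?thesis
    by (rule that(2)[OF 4(1) pq])
qed (blast intro: that(1,3))+

end

lemma hook_content_Suc_right:
  assumes "p < q"
  shows "hook_content p q = hook_content p (Suc q) \<circ> transpose q (Suc q)"
proof
  fix i
  have "q < i \<longleftrightarrow> Suc q < i" if "i \<noteq> Suc q" using that by linarith
  then show "hook_content p q i = (hook_content p (Suc q) \<circ> transpose q (Suc q)) i"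
    using assms by (cases "i = q"; cases "i = Suc q") (simp_all add: hook_content_def)
qed

lemma hook_content_Suc_left:
  assumes "Suc p < q"
  shows "hook_content p q = hook_content (Suc p) q \<circ> transpose p (Suc p)"
proof
  fix i
  have "p < i \<longleftrightarrow> Suc p < i" if "i \<noteq> Suc p" using that by linarith
  then show "hook_content p q i = (hook_content (Suc p) q \<circ> transpose p (Suc p)) i"
    using assms by (cases "i = p"; cases "i = Suc p") (simp_all add: hook_content_def)
qed

lemma hook_content_swap_induct:
  assumes "2 \<le> p" "p < q" "q \<le> n" and base: "P (hook_content (n - 1) n)"
    and step: "\<And>a i. \<lbrakk>1 \<le> i; i < n; \<bar>a i - a (Suc i)\<bar> \<noteq> 1; P a\<rbrakk> \<Longrightarrow> P (a \<circ> transpose i (Suc i))"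
  shows "P (hook_content p q)"
proof -
  have "P (hook_content p n)" if "p \<le> n - 1" "2 \<le> p"
    using that
  proof (induction p rule: inc_induct)
    case (step p)
    then have "\<bar>hook_content (Suc p) n p - hook_content (Suc p) n (Suc p)\<bar> \<noteq> 1"
      by (auto simp: hook_content_def)
    then have "P (hook_content (Suc p) n \<circ> transpose p (Suc p))"
      using step by (intro assms(5)) auto
    moreover have "Suc p < n" using step.hyps by simp
    ultimately show ?case by (simp only: hook_content_Suc_left[of p n])
  qed (rule base)
  then have last: "P (hook_content p n)" using assms(1-3) by simp
  show ?thesis
    using assms(3,2)
  proof (induction q rule: inc_induct)
    case (step q)
    then have "\<bar>hook_content p (Suc q) q - hook_content p (Suc q) (Suc q)\<bar> \<noteq> 1"
      using assms(1) by (auto simp: hook_content_def)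
    then have "P (hook_content p (Suc q) \<circ> transpose q (Suc q))"
      using step assms(1) by (intro assms(5)) auto
    then show ?case using step.prems by (simp only: hook_content_Suc_right[of p q])
  qed (rule last)
qed

lemma sum_hook_content:
  assumes "2 \<le> p" "p < q" "q \<le> n"
  shows "(\<Sum>i=1..n. hook_content p q i) = real n * (real n - 5) / 2"
proof (rule hook_content_swap_induct[OF assms])
  have "2 \<le> n" using assms by simp
  then have "(\<Sum>i=1..n. hook_content (n - 1) n i) = (\<Sum>i=1..n. two_point_weight n (-1) (-2) i)"
    by (intro sum.cong refl hook_content_last)
  then show "(\<Sum>i=1..n. hook_content (n - 1) n i) = real n * (real n - 5) / 2"
    using sum_two_point_weight[OF \<open>2 \<le> n\<close>] by (simp add: field_simps)
next
  fix a :: "nat \<Rightarrow> real" and i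
  assume "1 \<le> i" "i < n" and a: "(\<Sum>i=1..n. a i) = real n * (real n - 5) / 2"
  then have "transpose i (Suc i) permutes {1..n}" by (intro permutes_swap_id) auto
  from sum.permute[OF this, of a]
  show "(\<Sum>j=1..n. (a \<circ> transpose i (Suc i)) j) = real n * (real n - 5) / 2" using a by simp
qed

section \<open>Jucys--Murphy operators\<close>

text \<open>As a rewrite rule, \<open>uminus_apply\<close> would also expand negations of unapplied functions.\<close>

declare uminus_apply [simp del]

definition perms :: "nat \<Rightarrow> (nat \<Rightarrow> nat) set" where
  "perms n = {x. x permutes {1..n}}"

lemma finite_perms [simp]: "finite (perms n)"
  by (simp add: perms_def finite_permutations)

interpretation perms: inner_product_on "supported_on (perms n)" "inner_on (perms n)" for n
  by (rule inner_product_on_inner_on) simp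

lemma perms_comp_iff:
  assumes "g permutes {1..n}"
  shows "x \<circ> g \<in> perms n \<longleftrightarrow> x \<in> perms n"
proof
  assume "x \<circ> g \<in> perms n"
  then have "(x \<circ> g) \<circ> Hilbert_Choice.inv g permutes {1..n}"
    unfolding perms_def mem_Collect_eq by (rule permutes_compose[OF permutes_inv[OF assms]])
  then show "x \<in> perms n"
    unfolding perms_def by (simp only: comp_assoc permutes_inv_o(1)[OF assms] comp_id mem_Collect_eq)
qed (use assms in \<open>auto simp: perms_def intro: permutes_compose\<close>)

lemma perms_comp_transpose:
  "x \<in> perms n \<Longrightarrow> i \<in> {1..n} \<Longrightarrow> j \<in> {1..n} \<Longrightarrow> x \<circ> transpose i j \<in> perms n"
  by (simp add: perms_comp_iff permutes_swap_id)

definition right_translate :: "('a \<Rightarrow> 'a) \<Rightarrow> (('a \<Rightarrow> 'a) \<Rightarrow> real) \<Rightarrow> ('a \<Rightarrow> 'a) \<Rightarrow> real" where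
  "right_translate g f = (\<lambda>x. f (x \<circ> g))"

lemma linear_right_translate: "linear (right_translate g)"
  by (auto simp: linear_iff right_translate_def fun_eq_iff)

lemma right_translate_right_translate: "right_translate g (right_translate h f) = right_translate (g \<circ> h) f"
  by (simp add: right_translate_def comp_assoc)

lemma right_translate_supported_on_perms:
  "g permutes {1..n} \<Longrightarrow> f \<in> supported_on (perms n) \<Longrightarrow> right_translate g f \<in> supported_on (perms n)"
  by (simp add: supported_on_def right_translate_def perms_comp_iff)

lemma inner_on_right_translate:
  assumes "g permutes {1..n}" "g \<circ> g = id"
  shows "inner_on (perms n) (right_translate g f) h = inner_on (perms n) f (right_translate g h)"
  unfolding inner_on_def right_translate_def
  by (rule sum.reindex_bij_witness[where i = "\<lambda>x. x \<circ> g" and j = "\<lambda>x. x \<circ> g"])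
    (use assms in \<open>auto simp: perms_comp_iff comp_assoc\<close>)

definition JM :: "nat \<Rightarrow> ((nat \<Rightarrow> nat) \<Rightarrow> real) \<Rightarrow> (nat \<Rightarrow> nat) \<Rightarrow> real" where
  "JM k f = (\<Sum>i=1..<k. right_translate (transpose i k) f)"

lemma JM_apply: "JM k f x = (\<Sum>i=1..<k. f (x \<circ> transpose i k))"
  by (simp add: JM_def sum_fun_apply right_translate_def)

lemma linear_JM: "linear (JM k)"
  by (auto simp: linear_iff fun_eq_iff JM_apply sum.distrib sum_distrib_left)

lemma JM_supported_on_perms:
  assumes "k \<in> {1..n}" "f \<in> supported_on (perms n)"
  shows "JM k f \<in> supported_on (perms n)"
  unfolding JM_def
  by (intro subspace_sum subspace_supported_on right_translate_supported_on_perms permutes_swap_id)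
    (use assms in auto)

lemma inner_on_JM:
  assumes "k \<in> {1..n}"
  shows "inner_on (perms n) (JM k f) g = inner_on (perms n) f (JM k g)"
  unfolding JM_def perms.ip_simps
  by (intro sum.cong refl inner_on_right_translate permutes_swap_id) (use assms in auto)

lemma self_adjoint_on_JM: "k \<in> {1..n} \<Longrightarrow> perms.self_adjoint_on n W (JM k)"
  by (simp add: perms.self_adjoint_on_def inner_on_JM)

lemma JM_right_translate:
  assumes g: "g permutes {1..<k}"
  shows "JM k (right_translate g f) = right_translate g (JM k f)"
proof
  fix x
  have "g k = k" by (rule permutes_not_in[OF g]) simp
  then have "Hilbert_Choice.inv g k = k" using permutes_inverses(2)[OF g, of k] by simp
  then have "g \<circ> transpose i k = transpose (g i) k \<circ> g" for i
    using transpose_comp_eq[OF permutes_bij[OF g], of "g i" k] by (simp add: permutes_inverses(2)[OF g])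
  then have "right_translate g (JM k f) x = (\<Sum>i=1..<k. f (x \<circ> (transpose (g i) k \<circ> g)))"
    by (simp add: right_translate_def JM_apply comp_assoc)
  also have "\<dots> = (\<Sum>i=1..<k. f (x \<circ> (transpose i k \<circ> g)))"
    using sum.permute[OF g, of "\<lambda>i. f (x \<circ> (transpose i k \<circ> g))"] by (simp add: o_def)
  finally show "JM k (right_translate g f) x = right_translate g (JM k f) x"
    by (simp add: right_translate_def JM_apply comp_assoc)
qed

lemma JM_commute: "JM k (JM l f) = JM l (JM k f)"
proof -
  have "JM k (JM l f) = JM l (JM k f)" if "k < l" for k l
  proof -
    have "JM l (JM k f) = (\<Sum>i=1..<k. JM l (right_translate (transpose i k) f))"
      by (simp add: JM_def[of k] linear_sum[OF linear_JM])
    also have "\<dots> = (\<Sum>i=1..<k. right_translate (transpose i k) (JM l f))"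
      by (intro sum.cong refl JM_right_translate permutes_swap_id) (use that in auto)
    finally show ?thesis by (simp add: JM_def[of k])
  qed
  then show ?thesis by (cases k l rule: linorder_cases) auto
qed

definition adj_swap :: "nat \<Rightarrow> ((nat \<Rightarrow> nat) \<Rightarrow> real) \<Rightarrow> (nat \<Rightarrow> nat) \<Rightarrow> real" where
  "adj_swap i = right_translate (transpose i (Suc i))"

lemma linear_adj_swap: "linear (adj_swap i)"
  unfolding adj_swap_def by (rule linear_right_translate)

lemmas JM_simps = linear_add[OF linear_JM] linear_diff[OF linear_JM] linear_scale[OF linear_JM]
lemmas adj_swap_simps = linear_add[OF linear_adj_swap] linear_diff[OF linear_adj_swap]
  linear_scale[OF linear_adj_swap]

lemma adj_swap_adj_swap [simp]: "adj_swap i (adj_swap i f) = f"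
  by (simp add: adj_swap_def right_translate_right_translate) (simp add: right_translate_def)

lemma adj_swap_braid:
  "adj_swap i (adj_swap (Suc i) (adj_swap i f)) = adj_swap (Suc i) (adj_swap i (adj_swap (Suc i) f))"
proof -
  have "transpose i (Suc i) \<circ> (transpose (Suc i) (Suc (Suc i)) \<circ> transpose i (Suc i)) =
    transpose (Suc i) (Suc (Suc i)) \<circ> (transpose i (Suc i) \<circ> transpose (Suc i) (Suc (Suc i)))"
    by (auto simp: fun_eq_iff transpose_def)
  then show ?thesis by (simp add: adj_swap_def right_translate_right_translate comp_assoc)
qed

lemma adj_swap_supported_on_perms:
  "1 \<le> i \<Longrightarrow> i < n \<Longrightarrow> f \<in> supported_on (perms n) \<Longrightarrow> adj_swap i f \<in> supported_on (perms n)"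
  unfolding adj_swap_def by (intro right_translate_supported_on_perms permutes_swap_id) auto

lemma inner_on_adj_swap:
  "1 \<le> i \<Longrightarrow> i < n \<Longrightarrow> inner_on (perms n) (adj_swap i f) g = inner_on (perms n) f (adj_swap i g)"
  unfolding adj_swap_def by (intro inner_on_right_translate permutes_swap_id) auto

lemma JM_adj_swap_other:
  assumes "1 \<le> i" "k \<noteq> i" "k \<noteq> Suc i"
  shows "JM k (adj_swap i f) = adj_swap i (JM k f)"
proof (cases "k < i")
  case True
  have "transpose j k \<circ> transpose i (Suc i) = transpose i (Suc i) \<circ> transpose j k" if "j < k" for j
    using that True by (auto simp: fun_eq_iff transpose_def)
  then show ?thesis
    unfolding adj_swap_def JM_def linear_sum[OF linear_right_translate] right_translate_right_translate
    by (intro sum.cong) auto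
next
  case False
  then show ?thesis unfolding adj_swap_def
    by (intro JM_right_translate permutes_swap_id) (use assms in auto)
qed

lemma JM_Suc_adj_swap:
  assumes "1 \<le> i"
  shows "JM (Suc i) (adj_swap i f) = adj_swap i (JM i f) + f"
proof -
  have "transpose j (Suc i) \<circ> transpose i (Suc i) = transpose i (Suc i) \<circ> transpose j i" if "j < i" for j
    using that by (auto simp: fun_eq_iff transpose_def)
  then have "(\<Sum>j=1..<i. right_translate (transpose j (Suc i)) (adj_swap i f)) = adj_swap i (JM i f)"
    unfolding adj_swap_def JM_def linear_sum[OF linear_right_translate] right_translate_right_translate
    by (intro sum.cong) auto
  moreover have "right_translate (transpose i (Suc i)) (adj_swap i f) = f"
    unfolding adj_swap_def[symmetric] by simp
  ultimately show ?thesis using assms by (simp add: JM_def[of "Suc i"])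
qed

lemma JM_adj_swap:
  assumes "1 \<le> i"
  shows "JM i (adj_swap i f) = adj_swap i (JM (Suc i) f) - f"
  using JM_Suc_adj_swap[OF assms, of "adj_swap i f"] by (simp add: adj_swap_simps)

section \<open>Intertwiners\<close>

definition intertwiner :: "nat \<Rightarrow> ((nat \<Rightarrow> nat) \<Rightarrow> real) \<Rightarrow> (nat \<Rightarrow> nat) \<Rightarrow> real" where
  "intertwiner i f = adj_swap i (JM i f - JM (Suc i) f) + f"

lemma linear_intertwiner: "linear (intertwiner i)"
  by (auto simp: linear_iff intertwiner_def JM_simps adj_swap_simps algebra_simps)

lemma intertwiner_supported_on_perms:
  assumes "1 \<le> i" "i < n" "f \<in> supported_on (perms n)"
  shows "intertwiner i f \<in> supported_on (perms n)"
  unfolding intertwiner_def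
  by (intro subspace_add subspace_diff subspace_supported_on adj_swap_supported_on_perms JM_supported_on_perms)
    (use assms in auto)

lemma JM_intertwiner:
  assumes "1 \<le> i"
  shows "JM i (intertwiner i f) = intertwiner i (JM (Suc i) f)"
    and "JM (Suc i) (intertwiner i f) = intertwiner i (JM i f)"
    and "k \<noteq> i \<Longrightarrow> k \<noteq> Suc i \<Longrightarrow> JM k (intertwiner i f) = intertwiner i (JM k f)"
  using assms
  by (simp_all add: intertwiner_def JM_simps adj_swap_simps JM_adj_swap JM_Suc_adj_swap JM_adj_swap_other
      JM_commute algebra_simps)

lemma intertwiner_intertwiner:
  assumes "1 \<le> i"
  defines "D \<equiv> \<lambda>f. JM i f - JM (Suc i) f"
  shows "intertwiner i (intertwiner i f) = f - D (D f)"
proof -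
  have intertwiner: "intertwiner i g = adj_swap i (D g) + g" for g
    by (simp add: intertwiner_def D_def)
  have anti: "D (intertwiner i f) = - intertwiner i (D f)"
    using JM_intertwiner(1,2)[OF assms(1)] by (simp add: D_def linear_diff[OF linear_intertwiner])
  have "intertwiner i (intertwiner i f) = - adj_swap i (intertwiner i (D f)) + intertwiner i f"
    by (simp only: intertwiner[of "intertwiner i f"] anti linear_neg[OF linear_adj_swap])
  also have "\<dots> = f - D (D f)"
    by (simp add: intertwiner[of f] intertwiner[of "D f"] adj_swap_simps)
  finally show ?thesis .
qed

lemma inner_on_intertwiner:
  assumes "1 \<le> i" "i < n"
  shows "inner_on (perms n) (intertwiner i f) g = - inner_on (perms n) f (intertwiner i g)"
proof -
  have "inner_on (perms n) (intertwiner i f) g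
      = inner_on (perms n) f (JM i (adj_swap i g) - JM (Suc i) (adj_swap i g) + g)"
    using assms by (simp add: intertwiner_def perms.ip_simps inner_on_adj_swap inner_on_JM)
  also have "JM i (adj_swap i g) - JM (Suc i) (adj_swap i g) + g = - intertwiner i g"
    using assms by (simp add: JM_adj_swap JM_Suc_adj_swap intertwiner_def adj_swap_simps)
  finally show ?thesis by (simp add: perms.ip_simps)
qed

lemma in_span_JM_eigenvectors:
  assumes "k \<in> {1..n}" "f \<in> supported_on (perms n)" "shift_prod (JM k) cs f = 0"
  shows "f \<in> span {g \<in> supported_on (perms n). \<exists>c\<in>set cs. JM k g = c *\<^sub>R g}"
  by (rule perms.in_span_eigenvectors_if_shift_prod_eq_0[OF linear_JM subspace_supported_on order.refl
        JM_supported_on_perms[OF assms(1)] self_adjoint_on_JM[OF assms(1)] assms(2,3)])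

lemma shift_prod_JM_Suc_eq_0:
  assumes k: "1 \<le> k" "k < n" and killed: "\<And>g. g \<in> supported_on (perms n) \<Longrightarrow> shift_prod (JM k) cs g = 0"
    and f: "f \<in> supported_on (perms n)" "JM k f = c *\<^sub>R f"
  shows "shift_prod (JM (Suc k)) (cs @ [c + 1, c - 1]) f = 0"
proof -
  let ?J = "JM (Suc k)"
  have "JM k (?J f) = c *\<^sub>R ?J f"
    by (simp add: JM_commute[of k] f(2) JM_simps)
  then have "shift_prod ?J [c + 1, c - 1] f = - intertwiner k (intertwiner k f)"
    by (simp add: intertwiner_intertwiner[OF k(1)] JM_simps f(2) algebra_simps)
  then have "shift_prod ?J (cs @ [c + 1, c - 1]) f = - shift_prod ?J cs (intertwiner k (intertwiner k f))"
    by (simp only: shift_prod_append linear_neg[OF linear_shift_prod[OF linear_JM]])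
  moreover have "shift_prod ?J cs (intertwiner k (intertwiner k f))
      = intertwiner k (shift_prod (JM k) cs (intertwiner k f))"
    by (rule shift_prod_intertwine[of "intertwiner k" "JM k" ?J,
          OF linear_intertwiner JM_intertwiner(2)[OF k(1), symmetric], symmetric])
  moreover have "shift_prod (JM k) cs (intertwiner k f) = 0"
    by (rule killed) (rule intertwiner_supported_on_perms[OF k f(1)])
  ultimately show ?thesis by (simp add: linear_0[OF linear_intertwiner])
qed

lemma JM_shift_prod_eq_0:
  assumes "k \<in> {1..n}"
  shows "\<exists>cs. \<forall>f\<in>supported_on (perms n). shift_prod (JM k) cs f = 0"
  using assms
proof (induction k)
  case (Suc k)
  show ?case
  proof (cases "k = 0")
    case True
    then have "shift_prod (JM (Suc k)) [0] f = 0" for f by (simp add: JM_def)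
    then show ?thesis by blast
  next
    case False
    then have k: "1 \<le> k" "k < n" "k \<in> {1..n}" using Suc.prems by auto
    let ?V = "supported_on (perms n)"
    obtain cs where cs: "\<And>f. f \<in> ?V \<Longrightarrow> shift_prod (JM k) cs f = 0" using Suc.IH k(3) by blast
    let ?ds = "cs @ concat (map (\<lambda>c. [c + 1, c - 1]) cs)"
    have "shift_prod (JM (Suc k)) ?ds f = 0" if f: "f \<in> ?V" for f
    proof -
      let ?E = "{g. \<exists>d\<in>set ?ds. JM (Suc k) g = d *\<^sub>R g}"
      have "g \<in> span ?E" if g: "g \<in> ?V" "c \<in> set cs" "JM k g = c *\<^sub>R g" for g c
      proof -
        have "{h \<in> ?V. \<exists>d\<in>set (cs @ [c + 1, c - 1]). JM (Suc k) h = d *\<^sub>R h} \<subseteq> ?E"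
          using g(2) by auto
        from span_mono[OF this] show ?thesis
          using in_span_JM_eigenvectors[OF Suc.prems g(1) shift_prod_JM_Suc_eq_0[OF k(1,2) cs g(1,3)]] by blast
      qed
      then have "{g \<in> ?V. \<exists>c\<in>set cs. JM k g = c *\<^sub>R g} \<subseteq> span ?E" by blast
      from span_minimal[OF this subspace_span] have "f \<in> span ?E"
        using in_span_JM_eigenvectors[OF k(3) f cs[OF f]] by blast
      then show ?thesis
        by (rule shift_prod_eq_0_if_in_span_eigenvectors[OF linear_JM])
    qed
    then show ?thesis by blast
  qed
qed simp

section \<open>Weight spaces\<close>

definition weight_space :: "nat \<Rightarrow> (nat \<Rightarrow> real) \<Rightarrow> ((nat \<Rightarrow> nat) \<Rightarrow> real) set" where
  "weight_space n a = joint_eigenspace (supported_on (perms n)) JM {1..n} a"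

lemma weight_space_iff:
  "f \<in> weight_space n a \<longleftrightarrow> f \<in> supported_on (perms n) \<and> (\<forall>k\<in>{1..n}. JM k f = a k *\<^sub>R f)"
  by (simp add: weight_space_def joint_eigenspace_def)

lemma weight_spaceD:
  assumes "f \<in> weight_space n a"
  shows "f \<in> supported_on (perms n)" "k \<in> {1..n} \<Longrightarrow> JM k f = a k *\<^sub>R f"
  using assms by (auto simp: weight_space_iff)

lemma subspace_weight_space: "subspace (weight_space n a)"
  unfolding weight_space_def by (intro subspace_joint_eigenspace subspace_supported_on linear_JM)

lemma weight_space_cong:
  "(\<And>k. k \<in> {1..n} \<Longrightarrow> a k = b k) \<Longrightarrow> weight_space n a = weight_space n b"
  unfolding weight_space_def by (rule joint_eigenspace_cong)

definition weights :: "nat \<Rightarrow> (nat \<Rightarrow> real) set" where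
  "weights n = {a \<in> extensional {1..n}. \<exists>f\<in>weight_space n a. f \<noteq> 0}"

lemma weights_unique:
  assumes "a \<in> weights n" "b \<in> weights n" "f \<in> weight_space n a" "f \<in> weight_space n b" "f \<noteq> 0"
  shows "a = b"
proof (rule extensionalityI)
  show "a k = b k" if "k \<in> {1..n}" for k
    using weight_spaceD(2)[OF assms(3) that] weight_spaceD(2)[OF assms(4) that] assms(5) by simp
qed (use assms(1,2) in \<open>auto simp: weights_def\<close>)

lemma weight_space_restrict: "weight_space n (restrict a {1..n}) = weight_space n a"
  by (rule weight_space_cong) simp

lemma restrict_in_weights: "f \<in> weight_space n a \<Longrightarrow> f \<noteq> 0 \<Longrightarrow> restrict a {1..n} \<in> weights n"
  unfolding weights_def mem_Collect_eq weight_space_restrict by auto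

context
  fixes i n :: nat and f :: "(nat \<Rightarrow> nat) \<Rightarrow> real" and a :: "nat \<Rightarrow> real"
  assumes i: "1 \<le> i" "i < n" and f: "f \<in> weight_space n a"
begin

lemma intertwiner_weight: "intertwiner i f = (a i - a (Suc i)) *\<^sub>R adj_swap i f + f"
  using weight_spaceD(2)[OF f, of i] weight_spaceD(2)[OF f, of "Suc i"] i
  by (simp add: intertwiner_def adj_swap_simps algebra_simps)

lemma intertwiner_mem_weight_space: "intertwiner i f \<in> weight_space n (a \<circ> transpose i (Suc i))"
proof -
  have "JM k (intertwiner i f) = a (transpose i (Suc i) k) *\<^sub>R intertwiner i f" if k: "k \<in> {1..n}" for k
  proof -
    consider "k = i" | "k = Suc i" | "k \<noteq> i" "k \<noteq> Suc i" by blast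
    then show ?thesis
      using JM_intertwiner[OF i(1), where f = f] weight_spaceD(2)[OF f, of i] weight_spaceD(2)[OF f, of "Suc i"]
        weight_spaceD(2)[OF f k] i
      by cases (simp_all add: linear_scale[OF linear_intertwiner])
  qed
  then show ?thesis
    using intertwiner_supported_on_perms[OF i] f by (simp add: weight_space_iff)
qed

lemma intertwiner_intertwiner_weight: "intertwiner i (intertwiner i f) = (1 - (a i - a (Suc i))\<^sup>2) *\<^sub>R f"
proof -
  define d where "d = a i - a (Suc i)"
  have "JM i f - JM (Suc i) f = d *\<^sub>R f"
    using weight_spaceD(2)[OF f, of i] weight_spaceD(2)[OF f, of "Suc i"] i
    by (simp add: d_def scaleR_diff_left)
  then have "intertwiner i (intertwiner i f) = f - d *\<^sub>R d *\<^sub>R f"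
    by (simp only: intertwiner_intertwiner[OF i(1)] linear_scale[OF linear_JM] flip: scaleR_diff_right)
  then show ?thesis
    by (simp add: scaleR_diff_left power2_eq_square flip: d_def)
qed

lemma intertwiner_eq_0_imp_eq_0:
  assumes "\<bar>a i - a (Suc i)\<bar> \<noteq> 1" "intertwiner i f = 0"
  shows "f = 0"
  using intertwiner_intertwiner_weight assms
  by (simp add: linear_0[OF linear_intertwiner] power2_eq_1_iff abs_if split: if_splits)

lemma adj_swap_weight:
  assumes "\<bar>a i - a (Suc i)\<bar> = 1"
  shows "adj_swap i f = (a (Suc i) - a i) *\<^sub>R f"
proof -
  define d where "d = a i - a (Suc i)"
  let ?g = "intertwiner i f"
  have "d = 1 \<or> d = -1" using assms unfolding d_def by linarith
  then have "d * d = 1" by auto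
  then have "intertwiner i ?g = 0"
    using intertwiner_intertwiner_weight by (simp add: power2_eq_square flip: d_def)
  then have "inner_on (perms n) ?g ?g = 0"
    using inner_on_intertwiner[OF i, of f ?g] by (simp add: perms.ip_simps)
  then have "?g = 0"
    using intertwiner_supported_on_perms[OF i weight_spaceD(1)[OF f]] by (intro perms.ip_self_eq_0)
  then have "d *\<^sub>R d *\<^sub>R adj_swap i f = d *\<^sub>R (- f)"
    using intertwiner_weight by (simp only: add_eq_0_iff2 flip: d_def)
  then have "adj_swap i f = (- d) *\<^sub>R f" by (simp add: \<open>d * d = 1\<close>)
  then show ?thesis by (simp add: d_def)
qed

lemma weight_adjacent_neq:
  assumes "f \<noteq> 0"
  shows "a i \<noteq> a (Suc i)"
proof
  assume "a i = a (Suc i)"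
  then have "inner_on (perms n) f f = - inner_on (perms n) f f"
    using inner_on_intertwiner[OF i, of f f] intertwiner_weight by simp
  then show False
    using perms.ip_self_eq_0[OF weight_spaceD(1)[OF f]] assms by simp
qed

end

lemma weight_braid_neq:
  assumes f: "f \<in> weight_space n a" "f \<noteq> 0" and i: "1 \<le> i" "Suc i < n"
    and diff: "\<bar>a i - a (Suc i)\<bar> = 1"
  shows "a (Suc (Suc i)) \<noteq> a i"
proof
  assume eq: "a (Suc (Suc i)) = a i"
  let ?d = "a (Suc i) - a i"
  have "adj_swap i f = ?d *\<^sub>R f"
    by (rule adj_swap_weight[OF _ _ f(1) diff]) (use i in auto)
  moreover have "adj_swap (Suc i) f = (- ?d) *\<^sub>R f"
    using adj_swap_weight[OF _ i(2) f(1)] diff by (simp add: eq abs_minus_commute)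
  ultimately have "(?d * - ?d * ?d) *\<^sub>R f = (- ?d * ?d * - ?d) *\<^sub>R f"
    using adj_swap_braid[of i f] by (simp only: adj_swap_simps scaleR_scaleR)
  then have "?d = 0" using f(2) by auto
  then show False using diff by simp
qed

lemma weights_content_family:
  assumes "n \<ge> 1"
  shows "content_family n (weights n)"
proof
  show "0 < n" using assms by simp
next
  fix a assume "a \<in> weights n"
  then obtain f where f: "f \<in> weight_space n a" "f \<noteq> 0" and ext: "a \<in> extensional {1..n}"
    by (auto simp: weights_def)
  show "a 1 = 0"
    using weight_spaceD(2)[OF f(1), of 1] f(2) assms by (simp add: JM_def)
  show "a i \<noteq> a (Suc i)" if "1 \<le> i" "i < n" for i
    using weight_adjacent_neq[OF that f] .
  show "a \<circ> transpose i (Suc i) \<in> weights n"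
    if i: "1 \<le> i" "i < n" and diff: "\<bar>a i - a (Suc i)\<bar> \<noteq> 1" for i
  proof -
    have "a \<circ> transpose i (Suc i) \<in> extensional {1..n}"
      using ext i by (auto simp: extensional_def transpose_def)
    then show ?thesis
      using intertwiner_mem_weight_space[OF i f(1)] intertwiner_eq_0_imp_eq_0[OF i f(1) diff] f(2)
      by (auto simp: weights_def)
  qed
  show "a (Suc (Suc i)) \<noteq> a i" if "1 \<le> i" "Suc i < n" "\<bar>a i - a (Suc i)\<bar> = 1" for i
    using weight_braid_neq[OF f that] .
qed

lemma dim_weight_space_swap_le:
  assumes "1 \<le> i" "i < n" "\<bar>a i - a (Suc i)\<bar> \<noteq> 1"
  shows "dim (weight_space n a) \<le> dim (weight_space n (a \<circ> transpose i (Suc i)))"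
proof (rule dim_le_if_inj_on[OF linear_intertwiner[of i] subspace_weight_space])
  show "f = 0" if "f \<in> weight_space n a" "intertwiner i f = 0" for f
    using intertwiner_eq_0_imp_eq_0[OF assms(1,2) that(1) assms(3) that(2)] .
  show "intertwiner i ` weight_space n a \<subseteq> weight_space n (a \<circ> transpose i (Suc i))"
    using intertwiner_mem_weight_space[OF assms(1,2)] by blast
  show "weight_space n (a \<circ> transpose i (Suc i)) \<subseteq> span (unit_fun ` perms n)"
    using supported_on_unit_fun_basis(1)[OF finite_perms] weight_spaceD(1) by blast
qed simp

lemma dim_weight_space_swap:
  assumes "1 \<le> i" "i < n" "\<bar>a i - a (Suc i)\<bar> \<noteq> 1"
  shows "dim (weight_space n (a \<circ> transpose i (Suc i))) = dim (weight_space n a)"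
proof (rule antisym)
  let ?b = "a \<circ> transpose i (Suc i)"
  have "?b \<circ> transpose i (Suc i) = a" by (simp add: comp_assoc)
  moreover have "\<bar>?b i - ?b (Suc i)\<bar> \<noteq> 1" using assms(3) by auto
  ultimately show "dim (weight_space n ?b) \<le> dim (weight_space n a)"
    using dim_weight_space_swap_le[OF assms(1,2), of ?b] by metis
qed (rule dim_weight_space_swap_le[OF assms])

lemma weight_basis_exists:
  obtains B where "finite B" "independent B" "B \<subseteq> (\<Union>a. weight_space n a)" "card B = card (perms n)"
    "\<And>a. card (B \<inter> weight_space n a) = dim (weight_space n a)"
proof -
  let ?V = "supported_on (perms n)"
  have "?V \<subseteq> span (\<Union>a. joint_eigenspace ?V JM {1..n} a)"
    by (intro perms.subset_span_joint_eigenspaces linear_JM JM_supported_on_perms self_adjoint_on_JM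
        JM_commute JM_shift_prod_eq_0) auto
  with supported_on_unit_fun_basis[OF finite_perms, of n] obtain B
    where "finite B" "independent B" "B \<subseteq> (\<Union>a. joint_eigenspace ?V JM {1..n} a)" "card B = card (perms n)"
      "\<And>a. card (B \<inter> joint_eigenspace ?V JM {1..n} a) = dim (joint_eigenspace ?V JM {1..n} a)"
    using perms.joint_eigenbasis_exists[of "unit_fun ` perms n" n "{1..n}" JM]
    by (auto simp: linear_JM self_adjoint_on_JM)
  then show ?thesis by (rule that[unfolded weight_space_def])
qed

section \<open>Functions of the last two values\<close>

definition two_point :: "nat \<Rightarrow> (nat \<Rightarrow> nat \<Rightarrow> real) \<Rightarrow> (nat \<Rightarrow> nat) \<Rightarrow> real" where
  "two_point n h = (\<lambda>x. if x \<in> perms n then h (x (n - 1)) (x n) else 0)"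

lemma two_point_supported_on_perms: "two_point n h \<in> supported_on (perms n)"
  by (simp add: supported_on_def two_point_def)

lemma scaleR_two_point: "c *\<^sub>R two_point n h = two_point n (\<lambda>a b. c * h a b)"
  by (simp add: fun_eq_iff two_point_def)

lemma perms_last_two:
  assumes "x \<in> perms n" "2 \<le> n"
  shows "x (n - 1) \<in> {1..n}" "x n \<in> {1..n}" "x (n - 1) \<noteq> x n"
  using permutes_in_image[of x "{1..n}"] permutes_inj[of x "{1..n}"] assms by (auto simp: perms_def inj_eq)

definition perm_with_values :: "nat \<Rightarrow> nat \<Rightarrow> nat \<Rightarrow> nat \<Rightarrow> nat" where
  "perm_with_values n a b = transpose n b \<circ> transpose (n - 1) (transpose n b a)"

lemma perm_with_values:
  assumes "2 \<le> n" "a \<in> {1..n}" "b \<in> {1..n}" "a \<noteq> b"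
  shows "perm_with_values n a b \<in> perms n" "perm_with_values n a b (n - 1) = a"
    "perm_with_values n a b n = b"
proof -
  have "transpose n b a \<in> {1..n}" using assms by (auto simp: transpose_def)
  then show "perm_with_values n a b \<in> perms n"
    unfolding perm_with_values_def perms_def mem_Collect_eq
    by (intro permutes_compose permutes_swap_id) (use assms in auto)
  show "perm_with_values n a b (n - 1) = a" "perm_with_values n a b n = b"
    using assms by (auto simp: perm_with_values_def transpose_def)
qed

lemma two_point_perm_with_values:
  assumes "2 \<le> n" "a \<in> {1..n}" "b \<in> {1..n}" "a \<noteq> b"
  shows "two_point n h (perm_with_values n a b) = h a b"
  using perm_with_values[OF assms] by (simp add: two_point_def)

lemma two_point_eq_iff:
  assumes "2 \<le> n"
  shows "two_point n g = two_point n h \<longleftrightarrow> (\<forall>a\<in>{1..n}. \<forall>b\<in>{1..n}. a \<noteq> b \<longrightarrow> g a b = h a b)"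
proof
  assume "two_point n g = two_point n h"
  then show "\<forall>a\<in>{1..n}. \<forall>b\<in>{1..n}. a \<noteq> b \<longrightarrow> g a b = h a b"
    using two_point_perm_with_values[OF assms] by metis
next
  assume "\<forall>a\<in>{1..n}. \<forall>b\<in>{1..n}. a \<noteq> b \<longrightarrow> g a b = h a b"
  then show "two_point n g = two_point n h"
    using perms_last_two[OF _ assms] by (simp add: two_point_def fun_eq_iff)
qed

lemma two_point_comp_transpose:
  assumes "x \<in> perms n" "i \<in> {1..n}" "k \<in> {1..n}"
  shows "two_point n h (x \<circ> transpose i k) = h (x (transpose i k (n - 1))) (x (transpose i k n))"
  using perms_comp_transpose[OF assms] by (simp add: two_point_def)

lemma JM_two_pointI:
  assumes "k \<in> {1..n}"
    and "\<And>x. x \<in> perms n \<Longrightarrow> (\<Sum>i=1..<k. two_point n h (x \<circ> transpose i k)) = g (x (n - 1)) (x n)"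
  shows "JM k (two_point n h) = two_point n g"
proof
  fix x
  show "JM k (two_point n h) x = two_point n g x"
  proof (cases "x \<in> perms n")
    case True
    then show ?thesis using assms(2) by (simp add: JM_apply two_point_def)
  next
    case False
    then show ?thesis
      using JM_supported_on_perms[OF assms(1) two_point_supported_on_perms, of h]
      by (simp add: supported_on_def two_point_def)
  qed
qed

lemma sum_perms_init:
  fixes g :: "nat \<Rightarrow> real"
  assumes "x \<in> perms n" "2 \<le> n"
  shows "(\<Sum>i=1..<n - 1. g (x i)) = (\<Sum>c=1..n. g c) - g (x (n - 1)) - g (x n)"
proof -
  obtain m where m: "n = Suc (Suc m)" using assms(2) by (metis add_2_eq_Suc le_Suc_ex)
  have "(\<Sum>c=1..n. g c) = (\<Sum>i=1..n. g (x i))"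
    using sum.permute[of x "{1..n}" g] assms(1) by (simp add: perms_def o_def)
  also have "\<dots> = (\<Sum>i=1..<n - 1. g (x i)) + g (x (n - 1)) + g (x n)"
    by (simp add: m atLeastLessThanSuc_atLeastAtMost)
  finally show ?thesis by simp
qed

lemma JM_two_point_init:
  assumes "1 \<le> k" "k < n - 1"
  shows "JM k (two_point n h) = (real k - 1) *\<^sub>R two_point n h"
  unfolding scaleR_two_point
proof (rule JM_two_pointI)
  fix x assume x: "x \<in> perms n"
  have "two_point n h (x \<circ> transpose i k) = h (x (n - 1)) (x n)" if "i \<in> {1..<k}" for i
    using assms that by (subst two_point_comp_transpose[OF x]) (auto simp: transpose_def)
  then show "(\<Sum>i=1..<k. two_point n h (x \<circ> transpose i k)) = (real k - 1) * h (x (n - 1)) (x n)"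
    using assms by simp
qed (use assms in auto)

text \<open>\<open>two_point n h\<close> ignores the diagonal of \<open>h\<close>; setting it to zero lets row and column sums run over
  all of \<open>{1..n}\<close>.\<close>

context
  fixes n :: nat and h :: "nat \<Rightarrow> nat \<Rightarrow> real"
  assumes n: "2 \<le> n" and diag: "\<And>c. h c c = 0"
begin

lemma JM_two_point_penultimate:
  "JM (n - 1) (two_point n h) = two_point n (\<lambda>a b. (\<Sum>c=1..n. h c b) - h a b)"
proof (rule JM_two_pointI)
  fix x assume x: "x \<in> perms n"
  have "two_point n h (x \<circ> transpose i (n - 1)) = h (x i) (x n)" if "i \<in> {1..<n - 1}" for i
    using n that by (subst two_point_comp_transpose[OF x]) (auto simp: transpose_def)
  then show "(\<Sum>i=1..<n - 1. two_point n h (x \<circ> transpose i (n - 1)))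
      = (\<Sum>c=1..n. h c (x n)) - h (x (n - 1)) (x n)"
    using sum_perms_init[OF x n, of "\<lambda>c. h c (x n)"] diag perms_last_two[OF x n] by simp
qed (use n in auto)

lemma JM_two_point_last:
  "JM n (two_point n h) = two_point n (\<lambda>a b. (\<Sum>c=1..n. h a c) - h a b + h b a)"
proof (rule JM_two_pointI)
  fix x assume x: "x \<in> perms n"
  let ?t = "\<lambda>i. two_point n h (x \<circ> transpose i n)"
  have "?t i = h (x (n - 1)) (x i)" if "i \<in> {1..<n - 1}" for i
    using n that by (subst two_point_comp_transpose[OF x]) (auto simp: transpose_def)
  moreover have "?t (n - 1) = h (x n) (x (n - 1))"
    using n by (subst two_point_comp_transpose[OF x]) (auto simp: transpose_def)
  moreover have "(\<Sum>i=1..<n. ?t i) = (\<Sum>i=1..<n - 1. ?t i) + ?t (n - 1)"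
    using n sum.atLeastLessThan_Suc[of 1 "n - 1" ?t] by simp
  ultimately show "(\<Sum>i=1..<n. ?t i)
      = (\<Sum>c=1..n. h (x (n - 1)) c) - h (x (n - 1)) (x n) + h (x n) (x (n - 1))"
    using sum_perms_init[OF x n, of "h (x (n - 1))"] diag perms_last_two[OF x n] by simp
qed (use n in auto)

lemma two_point_mem_weight_space_iff:
  "two_point n h \<in> weight_space n (two_point_weight n \<alpha> \<beta>) \<longleftrightarrow>
    (\<forall>a\<in>{1..n}. \<forall>b\<in>{1..n}. a \<noteq> b \<longrightarrow>
      (\<Sum>c=1..n. h c b) - h a b = \<alpha> * h a b \<and> (\<Sum>c=1..n. h a c) - h a b + h b a = \<beta> * h a b)"
proof -
  let ?f = "two_point n h" and ?w = "two_point_weight n \<alpha> \<beta>"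
  have "{1..n} = {1..<n - 1} \<union> {n - 1, n}" using n by auto
  moreover have "JM k ?f = ?w k *\<^sub>R ?f" if "k \<in> {1..<n - 1}" for k
    using that JM_two_point_init[of k n h] by (auto simp: two_point_weight_def)
  moreover have "?w (n - 1) = \<alpha>" "?w n = \<beta>"
    using n by (auto simp: two_point_weight_def)
  ultimately have "?f \<in> weight_space n ?w \<longleftrightarrow> JM (n - 1) ?f = \<alpha> *\<^sub>R ?f \<and> JM n ?f = \<beta> *\<^sub>R ?f"
    by (auto simp: weight_space_iff two_point_supported_on_perms)
  then show ?thesis
    unfolding JM_two_point_penultimate JM_two_point_last scaleR_two_point two_point_eq_iff[OF n] by blast
qed

end

lemma zero_row_sums_if_zero_column_sums:
  fixes h :: "nat \<Rightarrow> nat \<Rightarrow> real"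
  assumes col: "\<And>b. b \<in> {1..n} \<Longrightarrow> (\<Sum>c=1..n. h c b) = 0"
    and row: "\<And>a b. a \<in> {1..n} \<Longrightarrow> b \<in> {1..n} \<Longrightarrow> a \<noteq> b \<Longrightarrow> (\<Sum>c=1..n. h a c) = - (h a b + h b a)"
    and a: "a \<in> {1..n}"
  shows "(\<Sum>c=1..n. h a c) = 0"
proof -
  have const: "(\<Sum>c=1..n. h b c) = (\<Sum>c=1..n. h a c)" if "b \<in> {1..n}" for b
    using row[of a b] row[of b a] that a by (cases "a = b") simp_all
  have "real n * (\<Sum>c=1..n. h a c) = (\<Sum>b=1..n. \<Sum>c=1..n. h a c)" by simp
  also have "\<dots> = (\<Sum>b=1..n. \<Sum>c=1..n. h b c)" by (intro sum.cong refl const[symmetric])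
  also have "\<dots> = (\<Sum>c=1..n. \<Sum>b=1..n. h b c)" by (rule sum.swap)
  also have "\<dots> = 0" using col by simp
  finally show ?thesis using a by simp
qed

lemma skew_zero_row_sums_iff:
  fixes h :: "nat \<Rightarrow> nat \<Rightarrow> real"
  assumes n: "2 \<le> n" and diag: "\<And>c. h c c = 0"
  shows "(\<forall>a\<in>{1..n}. \<forall>b\<in>{1..n}. a \<noteq> b \<longrightarrow>
      (\<Sum>c=1..n. h c b) = 0 \<and> (\<Sum>c=1..n. h a c) = - (h a b + h b a)) \<longleftrightarrow>
    (\<forall>a\<in>{1..n}. \<forall>b\<in>{1..n}. h b a = - h a b) \<and> (\<forall>a\<in>{1..n}. (\<Sum>c=1..n. h a c) = 0)"
    (is "?eqs \<longleftrightarrow> ?skew \<and> ?row")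
proof
  assume eqs: ?eqs
  have "(\<Sum>c=1..n. h c b) = 0" if "b \<in> {1..n}" for b
  proof -
    have "(if b = 1 then 2 else 1) \<in> {1..n}" "(if b = 1 then 2 else 1) \<noteq> b" using n by auto
    then show ?thesis using eqs that by blast
  qed
  then have row: ?row
    using zero_row_sums_if_zero_column_sums[of n h] eqs by blast
  have "h b a = - h a b" if "a \<in> {1..n}" "b \<in> {1..n}" for a b
  proof (cases "a = b")
    case False
    then have "(\<Sum>c=1..n. h a c) = - (h a b + h b a)" using eqs that by blast
    then show ?thesis using row that(1) by simp
  qed (simp add: diag)
  then show "?skew \<and> ?row" using row by blast
next
  assume "?skew \<and> ?row"
  then have skew: "h b a = - h a b" and row: "(\<Sum>c=1..n. h a c) = 0"
    if "a \<in> {1..n}" "b \<in> {1..n}" for a b using that by blast+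
  have "(\<Sum>c=1..n. h c b) = 0" if "b \<in> {1..n}" for b
  proof -
    have "(\<Sum>c=1..n. h c b) = (\<Sum>c=1..n. - h b c)"
      using skew that by (intro sum.cong refl) blast
    also have "\<dots> = 0" using row[OF that that] by (simp add: sum_negf)
    finally show ?thesis .
  qed
  moreover have "(\<Sum>c=1..n. h a c) = - (h a b + h b a)" if "a \<in> {1..n}" "b \<in> {1..n}" for a b
    using skew[OF that] row[OF that] by linarith
  ultimately show ?eqs by blast
qed

lemma two_point_mem_hook_weight_space_iff:
  assumes n: "2 \<le> n" and diag: "\<And>c. h c c = 0"
  shows "two_point n h \<in> weight_space n (hook_content (n - 1) n) \<longleftrightarrow>
    (\<forall>a\<in>{1..n}. \<forall>b\<in>{1..n}. h b a = - h a b) \<and> (\<forall>a\<in>{1..n}. (\<Sum>c=1..n. h a c) = 0)"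
proof -
  have "weight_space n (hook_content (n - 1) n) = weight_space n (two_point_weight n (-1) (-2))"
    using hook_content_last[OF n] by (rule weight_space_cong)
  moreover have "x - y = -1 * y \<and> z - y + v = -2 * y \<longleftrightarrow> x = 0 \<and> z = - (y + v)" for x y z v :: real
    by auto
  ultimately show ?thesis
    using two_point_mem_weight_space_iff[of n h "-1" "-2", OF n diag] skew_zero_row_sums_iff[of n h, OF n diag]
    by simp
qed

section \<open>The weight space of the hook\<close>

text \<open>\<open>k - 1\<close> is the number of summands of \<open>J\<^sub>k\<close>, each an isometry, so equality forces each to fix \<open>f\<close>.\<close>

lemma right_translate_eq_if_JM_top:
  assumes k: "k \<in> {1..n}" "i \<in> {1..<k}" and f: "f \<in> supported_on (perms n)" "JM k f = (real k - 1) *\<^sub>R f"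
  shows "right_translate (transpose i k) f = f"
proof -
  let ?T = "\<lambda>j. right_translate (transpose j k)" and ?ip = "inner_on (perms n)"
  have perm: "transpose j k permutes {1..n}" if "j \<in> {1..<k}" for j
    using that k by (intro permutes_swap_id) auto
  have mem: "?T j f - f \<in> supported_on (perms n)" if "j \<in> {1..<k}" for j
    using f(1) perm[OF that] by (intro subspace_diff subspace_supported_on right_translate_supported_on_perms)
  have "?ip (?T j f - f) (?T j f - f) = 2 * (?ip f f - ?ip (?T j f) f)" if "j \<in> {1..<k}" for j
  proof -
    have "?ip (?T j f) (?T j f) = ?ip f (?T j (?T j f))"
      by (rule inner_on_right_translate[OF perm[OF that]]) simp
    also have "?T j (?T j f) = f"
      by (simp add: right_translate_right_translate) (simp add: right_translate_def)
    finally show ?thesis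
      using perms.commute[of n f "?T j f"] by (simp add: perms.ip_simps)
  qed
  then have "(\<Sum>j=1..<k. ?ip (?T j f - f) (?T j f - f)) = (\<Sum>j=1..<k. 2 * (?ip f f - ?ip (?T j f) f))"
    by (intro sum.cong) auto
  also have "\<dots> = 2 * ((real k - 1) * ?ip f f - ?ip (JM k f) f)"
    using k by (simp add: JM_def perms.ip_simps sum_subtractf flip: sum_distrib_left)
  also have "\<dots> = 0" by (simp add: f(2) perms.ip_simps)
  finally have "?ip (?T i f - f) (?T i f - f) = 0"
    using sum_nonneg_eq_0_iff[of "{1..<k}" "\<lambda>j. ?ip (?T j f - f) (?T j f - f)"]
      perms.ip_self_nonneg[OF mem] k(2) by blast
  then show ?thesis using perms.ip_self_eq_0[OF mem[OF k(2)]] by simp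
qed

lemma weight_space_row_invariant:
  assumes f: "f \<in> weight_space n a" and m: "m \<le> n" and row: "\<And>k. k \<in> {1..m} \<Longrightarrow> a k = real k - 1"
    and s: "s permutes {1..m}"
  shows "right_translate s f = f"
proof -
  have less: "right_translate (transpose i k) f = f" if "i \<in> {1..<k}" "k \<in> {1..m}" for i k
    using weight_spaceD[OF f] row[OF that(2)] that m by (intro right_translate_eq_if_JM_top[of k n]) auto
  have transpose: "right_translate (transpose i k) f = f" if "i \<in> {1..m}" "k \<in> {1..m}" "i \<noteq> k" for i k
    using that less[of i k] less[of k i] by (cases i k rule: linorder_cases) (auto simp: transpose_commute)
  show ?thesis
    using s finite_atLeastAtMost
  proof (induction s rule: permutes_induct)
    case id
    show ?case by (simp add: right_translate_def o_def)
  next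
    case (swap i k s)
    then show ?case
      using transpose by (metis right_translate_right_translate)
  qed
qed

lemma weight_space_two_pointE:
  assumes f: "f \<in> weight_space n a" and n: "2 \<le> n"
    and row: "\<And>k. k \<in> {1..n - 2} \<Longrightarrow> a k = real k - 1"
  obtains g where "f = two_point n g" "\<And>c. g c c = 0"
proof
  define g where "g c d = (if c = d then 0 else f (perm_with_values n c d))" for c d
  show "g c c = 0" for c by (simp add: g_def)
  show "f = two_point n g"
  proof
    fix x
    show "f x = two_point n g x"
    proof (cases "x \<in> perms n")
      case False
      then show ?thesis using weight_spaceD(1)[OF f] by (simp add: supported_on_def two_point_def)
    next
      case True
      note ab = perms_last_two[OF True n]
      define y where "y = perm_with_values n (x (n - 1)) (x n)"
      note y = perm_with_values[OF n ab, folded y_def]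
      have x: "x permutes {1..n}" using True by (simp add: perms_def)
      define s where "s = Hilbert_Choice.inv x \<circ> y"
      have "s permutes {1..n}"
        using x y(1) unfolding s_def perms_def by (auto intro: permutes_compose permutes_inv)
      moreover have "s i = i" if "i \<in> {1..n} - {1..n - 2}" for i
      proof -
        have "i = n - 1 \<or> i = n" using that by auto
        then show ?thesis using y permutes_inverses(2)[OF x] by (auto simp: s_def)
      qed
      ultimately have "s permutes {1..n - 2}" by (rule permutes_superset)
      then have "f (x \<circ> s) = f x"
        using weight_space_row_invariant[OF f _ row] by (metis diff_le_self right_translate_def)
      moreover have "x \<circ> s = y" by (simp add: s_def o_assoc permutes_inv_o[OF x])
      ultimately show ?thesis using True ab(3) by (simp add: two_point_def g_def y_def)
    qed
  qed
qed

definition increasing_pairs :: "nat set \<Rightarrow> (nat \<times> nat) set" where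
  "increasing_pairs S = {(p, q). p \<in> S \<and> q \<in> S \<and> p < q}"

lemma finite_increasing_pairs: "finite S \<Longrightarrow> finite (increasing_pairs S)"
  by (rule finite_subset[of _ "S \<times> S"]) (auto simp: increasing_pairs_def)

lemma card_increasing_pairs:
  assumes "finite S"
  shows "card (increasing_pairs S) = card S choose 2"
  using assms
proof (induction S rule: finite_linorder_max_induct)
  case (insert b S)
  have "increasing_pairs (insert b S) = increasing_pairs S \<union> (\<lambda>p. (p, b)) ` S"
    using insert.hyps by (auto simp: increasing_pairs_def)
  moreover have "increasing_pairs S \<inter> (\<lambda>p. (p, b)) ` S = {}"
    using insert.hyps by (auto simp: increasing_pairs_def)
  moreover have "card ((\<lambda>p. (p, b)) ` S) = card S" by (intro card_image) (auto simp: inj_on_def)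
  moreover have "b \<notin> S" using insert.hyps by auto
  ultimately show ?case
    using insert by (simp add: card_Un_disjoint finite_increasing_pairs numeral_2_eq_2)
qed (simp add: increasing_pairs_def)

definition root_vec :: "nat \<Rightarrow> nat \<Rightarrow> nat \<Rightarrow> real" where
  "root_vec p q c = of_bool (c = p) - of_bool (c = q)"

lemma sum_root_vec:
  assumes "p \<in> {1..n}" "q \<in> {1..n}"
  shows "(\<Sum>c=1..n. root_vec p q c) = 0"
  using assms by (simp add: root_vec_def sum_subtractf of_bool_def)

lemma skew_zero_row_sums_eq_0:
  fixes g :: "nat \<Rightarrow> nat \<Rightarrow> real"
  assumes skew: "\<And>a b. a \<in> {1..n} \<Longrightarrow> b \<in> {1..n} \<Longrightarrow> g b a = - g a b"
    and row: "\<And>a. a \<in> {1..n} \<Longrightarrow> (\<Sum>c=1..n. g a c) = 0"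
    and zero: "\<And>p q. (p, q) \<in> increasing_pairs {1..n - 1} \<Longrightarrow> g p q = 0"
    and "a \<in> {1..n}" "b \<in> {1..n}"
  shows "g a b = 0"
proof -
  have inner: "g a b = 0" if "a \<in> {1..n - 1}" "b \<in> {1..n - 1}" for a b
    using that zero[of a b] zero[of b a] skew[of a b] skew[of a a]
    by (cases a b rule: linorder_cases) (auto simp: increasing_pairs_def)
  have last: "g a n = 0" if a: "a \<in> {1..n - 1}" for a
  proof -
    have "(\<Sum>c=1..n. g a c) = (\<Sum>c=1..n - 1. g a c) + g a n"
      using a by (cases n) auto
    also have "(\<Sum>c=1..n - 1. g a c) = 0" using inner[OF a] by simp
    finally show ?thesis using row[of a] a by auto
  qed
  have "a \<in> {1..n - 1} \<or> a = n" "b \<in> {1..n - 1} \<or> b = n"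
    using assms(4,5) by auto
  then consider "a \<in> {1..n - 1}" "b \<in> {1..n - 1}" | "a \<in> {1..n - 1}" "b = n"
    | "a = n" "b \<in> {1..n - 1}" | "a = n" "b = n"
    by blast
  then show ?thesis
    using inner[of a b] last[of a] last[of b] skew[of n b] skew[of n n] assms(4,5) by cases auto
qed

definition root_wedge :: "nat \<Rightarrow> nat \<times> nat \<Rightarrow> nat \<Rightarrow> nat \<Rightarrow> real" where
  "root_wedge n = (\<lambda>(p, q) a b. root_vec p n a * root_vec q n b - root_vec q n a * root_vec p n b)"

lemma two_point_root_wedge_mem_hook_weight_space:
  assumes "i \<in> increasing_pairs {1..n - 1}"
  shows "two_point n (root_wedge n i) \<in> weight_space n (hook_content (n - 1) n)"
proof -
  obtain p q where i: "i = (p, q)" "p \<in> {1..n}" "q \<in> {1..n}" "n \<in> {1..n}" "2 \<le> n"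
    using assms by (auto simp: increasing_pairs_def)
  then have "(\<Sum>c=1..n. root_wedge n i a c) = 0" for a
    using sum_root_vec[of p n n] sum_root_vec[of q n n]
    by (simp add: root_wedge_def sum_subtractf flip: sum_distrib_left)
  then show ?thesis
    using i(5) by (subst two_point_mem_hook_weight_space_iff) (auto simp: root_wedge_def i(1))
qed

lemma hook_weight_space_eq_0:
  assumes n: "2 \<le> n" and f: "f \<in> weight_space n (hook_content (n - 1) n)"
    and zero: "\<And>p q. (p, q) \<in> increasing_pairs {1..n - 1} \<Longrightarrow> f (perm_with_values n p q) = 0"
  shows "f = 0"
proof -
  obtain g where g: "f = two_point n g" and diag: "\<And>c. g c c = 0"
    by (rule weight_space_two_pointE[OF f n]) (auto simp: hook_content_def)
  have skew: "\<And>a b. a \<in> {1..n} \<Longrightarrow> b \<in> {1..n} \<Longrightarrow> g b a = - g a b"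
    and row: "\<And>a. a \<in> {1..n} \<Longrightarrow> (\<Sum>c=1..n. g a c) = 0"
    using f two_point_mem_hook_weight_space_iff[of n g, OF n diag] unfolding g by blast+
  have "g p q = 0" if pq: "(p, q) \<in> increasing_pairs {1..n - 1}" for p q
  proof -
    have "p \<in> {1..n}" "q \<in> {1..n}" "p \<noteq> q" using pq by (auto simp: increasing_pairs_def)
    then show ?thesis using zero[OF pq] two_point_perm_with_values[OF n, of p q g] g by simp
  qed
  then have "g a b = 0" if "a \<in> {1..n}" "b \<in> {1..n}" for a b
    using skew_zero_row_sums_eq_0[OF skew row _ that] by blast
  then have "two_point n g = two_point n (\<lambda>_ _. 0)"
    by (simp add: two_point_eq_iff[OF n])
  then show ?thesis by (simp add: g two_point_def fun_eq_iff)
qed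

lemma dim_hook_weight_space_last:
  assumes n: "3 \<le> n"
  shows "dim (weight_space n (hook_content (n - 1) n)) = (n - 1) choose 2"
proof -
  let ?W = "weight_space n (hook_content (n - 1) n)" and ?I = "increasing_pairs {1..n - 1}"
  have n2: "2 \<le> n" using n by simp
  have "dim ?W = card ?I"
  proof (rule dual_family_basis(2)[of _ _ "\<lambda>i. two_point n (root_wedge n i)"
        "\<lambda>(p, q). perm_with_values n p q"])
    show "(\<lambda>i. two_point n (root_wedge n i)) ` ?I \<subseteq> ?W"
      using two_point_root_wedge_mem_hook_weight_space by blast
    show "two_point n (root_wedge n i) (case j of (p, q) \<Rightarrow> perm_with_values n p q) = of_bool (i = j)"
      if ij: "i \<in> ?I" "j \<in> ?I" for i j
    proof -
      obtain p q where j: "j = (p, q)" "p \<in> {1..n - 1}" "q \<in> {1..n - 1}" "p < q"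
        using ij(2) by (auto simp: increasing_pairs_def)
      then have "two_point n (root_wedge n i) (perm_with_values n p q) = root_wedge n i p q"
        using n2 by (intro two_point_perm_with_values) auto
      also have "root_wedge n i p q = of_bool (i = (p, q))"
        using ij(1) j(2-4) by (cases i) (auto simp: root_wedge_def root_vec_def increasing_pairs_def)
      finally show ?thesis by (simp add: j(1))
    qed
    show "f = 0" if "f \<in> ?W" "\<And>i. i \<in> ?I \<Longrightarrow> f (case i of (p, q) \<Rightarrow> perm_with_values n p q) = 0" for f
      using hook_weight_space_eq_0[OF n2 that(1)] that(2) by fastforce
  qed (simp_all add: finite_increasing_pairs subspace_weight_space)
  then show ?thesis by (simp add: card_increasing_pairs)
qed

lemma dim_hook_weight_space:
  assumes "2 \<le> p" "p < q" "q \<le> n"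
  shows "dim (weight_space n (hook_content p q)) = (n - 1) choose 2"
proof (rule hook_content_swap_induct[OF assms])
  show "dim (weight_space n (hook_content (n - 1) n)) = (n - 1) choose 2"
    using assms by (intro dim_hook_weight_space_last) simp
next
  fix a i
  assume "1 \<le> i" "i < n" "\<bar>a i - a (Suc i)\<bar> \<noteq> 1" "dim (weight_space n a) = (n - 1) choose 2"
  then show "dim (weight_space n (a \<circ> transpose i (Suc i))) = (n - 1) choose 2"
    by (metis dim_weight_space_swap)
qed

section \<open>Attained content sums\<close>

definition weight_sums :: "nat \<Rightarrow> real set" where
  "weight_sums n = (\<lambda>a. \<Sum>k=1..n. a k) ` weights n"

lemma sum_in_weight_sums:
  assumes "f \<in> weight_space n a" "f \<noteq> 0"
  shows "(\<Sum>k=1..n. a k) \<in> weight_sums n"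
  unfolding weight_sums_def
  by (rule image_eqI[OF _ restrict_in_weights[OF assms]]) simp

lemma two_point_sum_in_weight_sums:
  assumes n: "2 \<le> n" and diag: "\<And>c. h c c = 0" and "h 1 2 \<noteq> 0"
    and col: "\<And>a b. a \<in> {1..n} \<Longrightarrow> b \<in> {1..n} \<Longrightarrow> a \<noteq> b \<Longrightarrow> (\<Sum>c=1..n. h c b) - h a b = \<alpha> * h a b"
    and row: "\<And>a b. a \<in> {1..n} \<Longrightarrow> b \<in> {1..n} \<Longrightarrow> a \<noteq> b \<Longrightarrow> (\<Sum>c=1..n. h a c) - h a b + h b a = \<beta> * h a b"
  shows "(real n - 2) * (real n - 3) / 2 + \<alpha> + \<beta> \<in> weight_sums n"
proof -
  have "two_point n h \<in> weight_space n (two_point_weight n \<alpha> \<beta>)"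
    using two_point_mem_weight_space_iff[OF n, of h] diag col row by blast
  moreover have "two_point n h \<noteq> 0"
    using two_point_perm_with_values[OF n, of 1 2 h] n \<open>h 1 2 \<noteq> 0\<close> by auto
  ultimately show ?thesis
    using sum_in_weight_sums sum_two_point_weight[OF n] by metis
qed

lemma one_point_sum_in_weight_sums:
  assumes n: "2 \<le> n" and "v 2 \<noteq> 0" and v: "\<And>b. (\<Sum>c=1..n. v c) - v b = \<beta> * v b"
  shows "(real n - 2) * (real n - 1) / 2 + \<beta> \<in> weight_sums n"
proof -
  let ?h = "\<lambda>a b. if a = b then 0 else v b"
  have off_diag: "(\<Sum>c=1..n. if c = b then 0 else u c) = (\<Sum>c=1..n. u c) - u b"
    if "b \<in> {1..n}" for b and u :: "nat \<Rightarrow> real"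
    using that by (simp add: sum.delta_remove sum_diff1)
  have "(real n - 2) * (real n - 3) / 2 + (real n - 2) + \<beta> \<in> weight_sums n"
  proof (rule two_point_sum_in_weight_sums[OF n])
    fix a b assume ab: "a \<in> {1..n}" "b \<in> {1..n}" "a \<noteq> b"
    show "(\<Sum>c=1..n. ?h c b) - ?h a b = (real n - 2) * ?h a b"
      using off_diag[OF ab(2), of "\<lambda>_. v b"] ab by (simp add: algebra_simps)
    show "(\<Sum>c=1..n. ?h a c) - ?h a b + ?h b a = \<beta> * ?h a b"
      using off_diag[OF ab(1), of v] ab v[of b] by (simp add: eq_commute[of a])
  qed (use \<open>v 2 \<noteq> 0\<close> in auto)
  then show ?thesis by (simp add: field_simps)
qed

lemma row_sum_in_weight_sums:
  assumes "2 \<le> n"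
  shows "real n * (real n - 1) / 2 \<in> weight_sums n"
  using one_point_sum_in_weight_sums[OF assms, of "\<lambda>_. 1" "real n - 1"] by (simp add: field_simps)

lemma near_row_sum_in_weight_sums:
  assumes "2 \<le> n"
  shows "real n * (real n - 3) / 2 \<in> weight_sums n"
  using one_point_sum_in_weight_sums[OF assms, of "root_vec 1 2" "-1"] sum_root_vec[of 1 n 2] assms
  by (simp add: root_vec_def field_simps)

lemma second_row_sum_in_weight_sums:
  assumes "4 \<le> n"
  shows "(real n - 1) * (real n - 4) / 2 \<in> weight_sums n"
proof -
  define h where "h a b = root_vec 1 3 a * root_vec 2 4 b + root_vec 2 4 a * root_vec 1 3 b" for a b
  have "(\<Sum>c=1..n. root_vec 1 3 c) = 0" "(\<Sum>c=1..n. root_vec 2 4 c) = 0"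
    by (rule sum_root_vec; use assms in simp)+
  then have "(\<Sum>c=1..n. h a c) = 0" "(\<Sum>c=1..n. h c a) = 0" for a
    by (simp_all add: h_def sum.distrib flip: sum_distrib_left sum_distrib_right)
  then have "(real n - 2) * (real n - 3) / 2 + -1 + 0 \<in> weight_sums n"
    using assms by (intro two_point_sum_in_weight_sums[of n h]) (auto simp: h_def root_vec_def)
  then show ?thesis by (simp add: field_simps)
qed

section \<open>Characteristic polynomials from eigenfunctions\<close>

lemma order_prod_linear_factors:
  fixes as :: "'a::field list"
  shows "Polynomial.order x (\<Prod>a\<leftarrow>as. [:- a, 1:]) = count_list as x"
proof (induction as)
  case (Cons a as)
  have "Polynomial.order x [:- a, 1:] = of_bool (a = x)"
    using order_power_n_n[of x 1] order_0I[of "[:- a, 1:]" x] by auto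
  moreover have "(\<Prod>a\<leftarrow>as. [:- a, 1:]) \<noteq> 0" by auto
  ultimately show ?case
    using Cons by (simp add: order_mult del: mult_pCons_left)
qed simp

lemma char_poly_if_diagonalised:
  fixes M P :: "'a::field mat"
  assumes M: "M \<in> carrier_mat N N" and P: "P \<in> carrier_mat N N" "det P \<noteq> 0"
    and MP: "M * P = P * mat_diag N d"
  shows "char_poly M = (\<Prod>a\<leftarrow>map d [0..<N]. [:- a, 1:])"
proof -
  obtain Q where Q: "Q \<in> carrier_mat N N" "P * Q = 1\<^sub>m N" "Q * P = 1\<^sub>m N"
    using det_non_zero_imp_unit[OF P, of "()"] unfolding Units_def ring_mat_def by auto
  have "M = M * (P * Q)" using M Q by simp
  also have "\<dots> = P * mat_diag N d * Q" using MP M P(1) Q(1) by (metis assoc_mult_mat)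
  finally have "similar_mat M (mat_diag N d)"
    using M P(1) Q by (intro similar_matI[of _ _ P Q N]) auto
  then have "char_poly M = char_poly (mat_diag N d)" by (rule char_poly_similar)
  also have "\<dots> = (\<Prod>a\<leftarrow>diag_mat (mat_diag N d). [:- a, 1:])"
    by (rule char_poly_upper_triangular[of _ N]) (auto simp: mat_diag_def)
  also have "diag_mat (mat_diag N d) = map d [0..<N]"
    by (auto simp: diag_mat_def mat_diag_def)
  finally show ?thesis .
qed

definition value_mat :: "'a list \<Rightarrow> ('a \<Rightarrow> real) list \<Rightarrow> real mat" where
  "value_mat vs bs = mat (length vs) (length bs) (\<lambda>(r, c). (bs ! c) (vs ! r))"

lemma value_mat_mult_vec:
  assumes "v \<in> carrier_vec (length bs)" "r < length vs"
  shows "(value_mat vs bs *\<^sub>v v) $ r = (\<Sum>c<length bs. v $ c *\<^sub>R (bs ! c)) (vs ! r)"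
  using assms by (simp add: value_mat_def scalar_prod_def sum_fun_apply lessThan_atLeast0 mult.commute)

lemma sum_nth_eq_0_if_value_mat_mult_vec_eq_0:
  assumes "set bs \<subseteq> supported_on (set vs)" "v \<in> carrier_vec (length bs)"
    and zero: "value_mat vs bs *\<^sub>v v = 0\<^sub>v (length vs)"
  shows "(\<Sum>c<length bs. v $ c *\<^sub>R (bs ! c)) = 0"
proof
  fix x
  show "(\<Sum>c<length bs. v $ c *\<^sub>R (bs ! c)) x = 0 x"
  proof (cases "x \<in> set vs")
    case True
    then obtain r where "r < length vs" "x = vs ! r" by (auto simp: in_set_conv_nth)
    then show ?thesis using value_mat_mult_vec[OF assms(2), of r vs] by (simp add: zero)
  next
    case False
    then have "(bs ! c) x = 0" if "c < length bs" for c
      using assms(1) nth_mem[OF that] by (auto simp: supported_on_def)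
    then show ?thesis by (simp add: sum_fun_apply)
  qed
qed

lemma det_value_mat_neq_0:
  assumes len: "length bs = length vs" and "distinct bs" and indep: "independent (set bs)"
    and supp: "set bs \<subseteq> supported_on (set vs)"
  shows "det (value_mat vs bs) \<noteq> 0"
proof
  let ?N = "length vs" and ?P = "value_mat vs bs"
  have P: "?P \<in> carrier_mat ?N ?N" by (simp add: value_mat_def len)
  assume "det ?P = 0"
  then obtain v where v: "v \<in> carrier_vec ?N" "v \<noteq> 0\<^sub>v ?N" "?P *\<^sub>v v = 0\<^sub>v ?N"
    using det_0_iff_vec_prod_zero[OF P] by auto
  have inj: "inj_on ((!) bs) {..<?N}"
    using inj_on_nth[OF \<open>distinct bs\<close>] len by simp
  have set: "set bs = (!) bs ` {..<?N}"
    using len by (auto simp: set_conv_nth)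
  define u where "u b = v $ inv_into {..<?N} ((!) bs) b" for b
  have u: "u (bs ! c) = v $ c" if "c < ?N" for c
    using inv_into_f_f[OF inj] that by (simp add: u_def)
  have "(\<Sum>b\<in>set bs. u b *\<^sub>R b) = (\<Sum>c<?N. v $ c *\<^sub>R (bs ! c))"
    unfolding set sum.reindex[OF inj] by (simp add: u)
  also have "\<dots> = 0"
    using sum_nth_eq_0_if_value_mat_mult_vec_eq_0[OF supp] v len by simp
  finally have "u b = 0" if "b \<in> set bs" for b
    using independentD[OF indep _ order.refl _ that] by simp
  then have "v $ c = 0" if "c < ?N" for c
    using u[OF that] that by (simp add: set)
  then have "v = 0\<^sub>v ?N" using v(1) by (intro eq_vecI) auto
  then show False using v(2) by contradiction
qed

lemma char_poly_eigenbasis: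
  fixes vs :: "'a list" and bs :: "('a \<Rightarrow> real) list"
  assumes M: "M \<in> carrier_mat (length vs) (length vs)"
    and len: "length bs = length vs" and "distinct bs" "independent (set bs)" "set bs \<subseteq> supported_on (set vs)"
    and eigen: "\<And>b r. b \<in> set bs \<Longrightarrow> r < length vs \<Longrightarrow>
      (\<Sum>j<length vs. M $$ (r, j) * b (vs ! j)) = \<theta> b * b (vs ! r)"
  shows "char_poly M = (\<Prod>a\<leftarrow>map \<theta> bs. [:- a, 1:])"
proof -
  let ?N = "length vs" and ?P = "value_mat vs bs" and ?d = "\<lambda>c. \<theta> (bs ! c)"
  have P: "?P \<in> carrier_mat ?N ?N" by (simp add: value_mat_def len)
  have "M * ?P = ?P * mat_diag ?N ?d"
    unfolding mat_diag_mult_right[OF P]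
  proof (rule eq_matI)
    fix r c assume "r < dim_row (mat ?N ?N (\<lambda>(i, j). ?P $$ (i, j) * ?d j))"
      "c < dim_col (mat ?N ?N (\<lambda>(i, j). ?P $$ (i, j) * ?d j))"
    then have rc: "r < ?N" "c < ?N" by auto
    have "(M * ?P) $$ (r, c) = (\<Sum>j<?N. M $$ (r, j) * (bs ! c) (vs ! j))"
      using rc M P len by (simp add: scalar_prod_def value_mat_def lessThan_atLeast0)
    also have "\<dots> = ?d c * (bs ! c) (vs ! r)"
      using eigen rc len by simp
    finally show "(M * ?P) $$ (r, c) = mat ?N ?N (\<lambda>(i, j). ?P $$ (i, j) * ?d j) $$ (r, c)"
      using rc len by (simp add: value_mat_def)
  qed (use M P in auto)
  from char_poly_if_diagonalised[OF M P _ this] have "char_poly M = (\<Prod>a\<leftarrow>map ?d [0..<?N]. [:- a, 1:])"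
    using det_value_mat_neq_0 assms(2-5) by blast
  also have "map ?d [0..<?N] = map \<theta> bs"
    using len by (intro nth_equalityI) auto
  finally show ?thesis .
qed

section \<open>The spectrum of the transposition graph\<close>

lemma transpositions_eq: "transpositions n = (\<lambda>(k, i). transpose i k) ` (SIGMA k:{1..n}. {1..<k})"
proof (intro equalityI subsetI)
  fix s assume "s \<in> transpositions n"
  then obtain i j where "i \<in> {1..n}" "j \<in> {1..n}" "i \<noteq> j" "s = transpose i j"
    by (auto simp: transpositions_def)
  then have "(max i j, min i j) \<in> (SIGMA k:{1..n}. {1..<k})" "s = transpose (min i j) (max i j)"
    by (auto simp: min_def max_def transpose_commute)
  then show "s \<in> (\<lambda>(k, i). transpose i k) ` (SIGMA k:{1..n}. {1..<k})"
    by (intro image_eqI[of _ _ "(max i j, min i j)"]) auto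
next
  fix s assume "s \<in> (\<lambda>(k, i). transpose i k) ` (SIGMA k:{1..n}. {1..<k})"
  then obtain i k where ik: "k \<in> {1..n}" "i \<in> {1..<k}" "s = transpose i k" by auto
  then have "i \<in> {1..n}" "i \<noteq> k" by auto
  with ik show "s \<in> transpositions n" unfolding transpositions_def by blast
qed

lemma inj_on_transpose: "inj_on (\<lambda>(k, i). transpose i k) (SIGMA k:{1..n}. {1..<k::nat})"
proof (rule inj_onI, clarify)
  fix k i k' i' :: nat
  assume less: "i \<in> {1..<k}" "i' \<in> {1..<k'}" and eq: "transpose i k = transpose i' k'"
  have "transpose i' k' i = k" "transpose i' k' k = i" by (simp_all flip: eq)
  with less show "k = k' \<and> i = i'" by (auto simp: transpose_def split: if_splits)
qed

lemma sum_neighbours_eq_sum_JM: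
  assumes x: "x \<in> perms n"
  shows "(\<Sum>y\<in>perms n. of_bool ((x, y) \<in> parcs (transposition_graph n)) * f y) = (\<Sum>k=1..n. JM k f x)"
proof -
  have arc: "(x, y) \<in> parcs (transposition_graph n) \<longleftrightarrow> y \<in> (\<circ>) x ` transpositions n" for y
    using x by (auto simp: transposition_graph_def cayley_graph_def sym_group_def perms_def)
  have inj: "inj_on ((\<circ>) x) (transpositions n)"
  proof (rule inj_onI)
    have "inj x" using x permutes_inj by (auto simp: perms_def)
    fix s t :: "nat \<Rightarrow> nat" assume "x \<circ> s = x \<circ> t"
    then show "s = t" using \<open>inj x\<close> by (simp add: fun_eq_iff inj_eq)
  qed
  have sub: "(\<circ>) x ` transpositions n \<subseteq> perms n"
    using perms_comp_transpose[OF x] by (auto simp: transpositions_def)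
  have "(\<Sum>y\<in>perms n. of_bool ((x, y) \<in> parcs (transposition_graph n)) * f y)
      = (\<Sum>y\<in>(\<circ>) x ` transpositions n. f y)"
    using sub by (intro sum.mono_neutral_cong_right) (auto simp: arc)
  also have "\<dots> = (\<Sum>s\<in>transpositions n. f (x \<circ> s))"
    by (simp add: sum.reindex[OF inj])
  also have "\<dots> = (\<Sum>(k, i)\<in>(SIGMA k:{1..n}. {1..<k}). f (x \<circ> transpose i k))"
    unfolding transpositions_eq sum.reindex[OF inj_on_transpose] by (intro sum.cong) auto
  also have "\<dots> = (\<Sum>k=1..n. JM k f x)"
    unfolding JM_apply by (rule sum.Sigma[symmetric]) auto
  finally show ?thesis .
qed

lemma vertex_enumeration_transposition_graph_iff:
  "vertex_enumeration (transposition_graph n) vs \<longleftrightarrow> distinct vs \<and> set vs = perms n"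
  by (simp add: vertex_enumeration_def transposition_graph_def cayley_graph_def sym_group_def perms_def)

lemma adjacency_matrix_transposition_graph_sum:
  assumes vs: "distinct vs" "set vs = perms n" and r: "r < length vs"
  shows "(\<Sum>j<length vs. adjacency_matrix (transposition_graph n) vs $$ (r, j) * f (vs ! j))
    = (\<Sum>k=1..n. JM k f (vs ! r))"
proof -
  let ?g = "\<lambda>y. of_bool ((vs ! r, y) \<in> parcs (transposition_graph n)) * f y"
  have "(\<Sum>j<length vs. adjacency_matrix (transposition_graph n) vs $$ (r, j) * f (vs ! j))
      = (\<Sum>j<length vs. ?g (vs ! j))"
    using r by (intro sum.cong) (auto simp: adjacency_matrix_def)
  also have "\<dots> = (\<Sum>y\<in>perms n. ?g y)"
    using sum.reindex_bij_betw[OF bij_betw_nth[OF vs(1) refl vs(2)[symmetric]], of ?g] .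
  also have "\<dots> = (\<Sum>k=1..n. JM k f (vs ! r))"
    using nth_mem[OF r] vs(2) by (simp only: sum_neighbours_eq_sum_JM)
  finally show ?thesis .
qed

lemma dim_weight_space_pos_iff: "0 < dim (weight_space n a) \<longleftrightarrow> (\<exists>f\<in>weight_space n a. f \<noteq> 0)"
proof -
  have "weight_space n a \<subseteq> span (unit_fun ` perms n)"
    using supported_on_unit_fun_basis(1)[OF finite_perms] weight_spaceD(1) by blast
  then have "dim (weight_space n a) = 0 \<longleftrightarrow> weight_space n a \<subseteq> {0}"
    by (intro dim_eq_0_iff_if_subset_span[of "unit_fun ` perms n"]) auto
  then show ?thesis by auto
qed

lemma weight_eigenbasis_exists:
  obtains bs wt where "distinct bs" "independent (set bs)" "set bs \<subseteq> supported_on (perms n)"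
    "length bs = card (perms n)" "wt ` set bs = weights n" "\<And>b. b \<in> set bs \<Longrightarrow> b \<in> weight_space n (wt b)"
    "\<And>a. a \<in> weights n \<Longrightarrow> card {b \<in> set bs. wt b = a} = dim (weight_space n a)"
proof -
  obtain B where B: "finite B" "independent B" "B \<subseteq> (\<Union>a. weight_space n a)" "card B = card (perms n)"
    and dims: "\<And>a. card (B \<inter> weight_space n a) = dim (weight_space n a)"
    by (rule weight_basis_exists[of n]) blast
  have nonzero: "b \<noteq> 0" if "b \<in> B" for b using that B(2) dependent_zero by blast
  have "\<exists>a\<in>weights n. b \<in> weight_space n a" if "b \<in> B" for b
    using B(3) that restrict_in_weights[OF _ nonzero[OF that]] weight_space_restrict by blast
  then obtain wt where wt: "wt b \<in> weights n" "b \<in> weight_space n (wt b)" if "b \<in> B" for b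
    by metis
  have "{b \<in> B. wt b = a} = B \<inter> weight_space n a" if "a \<in> weights n" for a
    using wt weights_unique[OF wt(1) that wt(2) _ nonzero] by blast
  then have card: "card {b \<in> B. wt b = a} = dim (weight_space n a)" if "a \<in> weights n" for a
    using that dims by simp
  have "a \<in> wt ` B" if a: "a \<in> weights n" for a
  proof -
    have "0 < card {b \<in> B. wt b = a}"
      using card[OF a] dim_weight_space_pos_iff[of n a] a by (simp add: weights_def)
    then show ?thesis by (auto simp: card_gt_0_iff)
  qed
  then have img: "wt ` B = weights n" using wt(1) by blast
  obtain bs where bs: "set bs = B" "distinct bs" using finite_distinct_list[OF B(1)] by blast
  show ?thesis
  proof (rule that[of bs wt])
    show "length bs = card (perms n)" using bs B(4) distinct_card by metis
    show "set bs \<subseteq> supported_on (perms n)" using B(3) weight_spaceD(1) bs(1) by blast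
  qed (simp_all only: bs B(2) img wt(2) card not_False_eq_True)
qed

lemma char_poly_transposition_graph:
  assumes "vertex_enumeration (transposition_graph n) vs"
  obtains bs :: "((nat \<Rightarrow> nat) \<Rightarrow> real) list" and wt where "distinct bs" "wt ` set bs = weights n"
    "\<forall>a\<in>weights n. card {b \<in> set bs. wt b = a} = dim (weight_space n a)"
    "char_poly (adjacency_matrix (transposition_graph n) vs) = (\<Prod>\<theta>\<leftarrow>map (\<lambda>b. \<Sum>k=1..n. wt b k) bs. [:- \<theta>, 1:])"
proof -
  have vs: "distinct vs" "set vs = perms n"
    using assms by (simp_all add: vertex_enumeration_transposition_graph_iff)
  obtain bs wt where bs: "distinct bs" "independent (set bs)" "set bs \<subseteq> supported_on (perms n)"
      "length bs = card (perms n)"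
    and wt: "wt ` set bs = weights n" "\<And>b. b \<in> set bs \<Longrightarrow> b \<in> weight_space n (wt b)"
      "\<And>a. a \<in> weights n \<Longrightarrow> card {b \<in> set bs. wt b = a} = dim (weight_space n a)"
    by (rule weight_eigenbasis_exists[of n]) blast
  have "char_poly (adjacency_matrix (transposition_graph n) vs) = (\<Prod>\<theta>\<leftarrow>map (\<lambda>b. \<Sum>k=1..n. wt b k) bs. [:- \<theta>, 1:])"
  proof (rule char_poly_eigenbasis)
    show "length bs = length vs" using bs(4) vs distinct_card by metis
    fix b r assume b: "b \<in> set bs" and r: "r < length vs"
    show "(\<Sum>j<length vs. adjacency_matrix (transposition_graph n) vs $$ (r, j) * b (vs ! j))
        = (\<Sum>k=1..n. wt b k) * b (vs ! r)"
      unfolding adjacency_matrix_transposition_graph_sum[OF vs r]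
      using weight_spaceD(2)[OF wt(2)[OF b]] by (simp add: sum_distrib_right)
  qed (use bs vs in \<open>auto simp: adjacency_matrix_def\<close>)
  then show ?thesis using that bs(1) wt(1,3) by blast
qed

lemma transposition_graph_spectrum:
  fixes \<theta> :: real
  assumes "vertex_enumeration (transposition_graph n) vs"
  defines "A \<equiv> adjacency_matrix (transposition_graph n) vs"
  shows "eigenvalue A \<theta> \<longleftrightarrow> \<theta> \<in> weight_sums n"
    and "eigenvalue_multiplicity A \<theta> = (\<Sum>a | a \<in> weights n \<and> (\<Sum>k=1..n. a k) = \<theta>. dim (weight_space n a))"
proof -
  have A: "A \<in> carrier_mat (length vs) (length vs)" by (simp add: A_def adjacency_matrix_def)
  obtain bs :: "((nat \<Rightarrow> nat) \<Rightarrow> real) list" and wt where bs: "distinct bs" and wt: "wt ` set bs = weights n"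
      "\<forall>a\<in>weights n. card {b \<in> set bs. wt b = a} = dim (weight_space n a)"
    and char: "char_poly A = (\<Prod>\<theta>\<leftarrow>map (\<lambda>b. \<Sum>k=1..n. wt b k) bs. [:- \<theta>, 1:])"
    unfolding A_def by (rule char_poly_transposition_graph[OF assms(1)])
  let ?s = "\<lambda>b. \<Sum>k=1..n. wt b k" and ?W = "{a \<in> weights n. (\<Sum>k=1..n. a k) = \<theta>}"
  have "eigenvalue A \<theta> \<longleftrightarrow> \<theta> \<in> ?s ` set bs"
    unfolding eigenvalue_root_char_poly[OF A] char by (auto simp: poly_prod_list)
  also have "?s ` set bs = weight_sums n"
    unfolding weight_sums_def wt(1)[symmetric] image_image ..
  finally show "eigenvalue A \<theta> \<longleftrightarrow> \<theta> \<in> weight_sums n" .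
  have "finite (weights n)" unfolding wt(1)[symmetric] by simp
  then have fin: "finite ?W" by simp
  have "eigenvalue_multiplicity A \<theta> = length (filter (\<lambda>b. ?s b = \<theta>) bs)"
    unfolding eigenvalue_multiplicity_def char order_prod_linear_factors count_list_eq_length_filter
    by (simp add: filter_map o_def eq_commute[of \<theta>])
  also have "\<dots> = card {b \<in> set bs. ?s b = \<theta>}"
    using distinct_length_filter[OF bs] by (simp add: Int_def conj_commute)
  also have "{b \<in> set bs. ?s b = \<theta>} = (\<Union>a\<in>?W. {b \<in> set bs. wt b = a})"
    using wt(1) by blast
  also have "card \<dots> = (\<Sum>a\<in>?W. card {b \<in> set bs. wt b = a})"
    using fin by (intro card_UN_disjoint) auto
  also have "\<dots> = (\<Sum>a\<in>?W. dim (weight_space n a))"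
    using wt(2) by (intro sum.cong) auto
  finally show "eigenvalue_multiplicity A \<theta> = (\<Sum>a\<in>?W. dim (weight_space n a))" .
qed

lemma weights_content_seq:
  assumes "1 \<le> n" "a \<in> weights n"
  shows "content_seq n a"
  using content_family.content_seq[OF weights_content_family] assms by blast

definition hook_weight :: "nat \<Rightarrow> nat \<times> nat \<Rightarrow> nat \<Rightarrow> real" where
  "hook_weight n = (\<lambda>(p, q). restrict (hook_content p q) {1..n})"

lemma hook_weight_space: "weight_space n (hook_weight n (p, q)) = weight_space n (hook_content p q)"
  unfolding hook_weight_def prod.case by (rule weight_space_restrict)

lemma inj_on_hook_weight: "inj_on (hook_weight n) (increasing_pairs {2..n})"
proof (rule inj_onI, clarify)
  fix p q p' q'
  assume pq: "(p, q) \<in> increasing_pairs {2..n}" "(p', q') \<in> increasing_pairs {2..n}"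
    and "hook_weight n (p, q) = hook_weight n (p', q')"
  then have "hook_content p q k = hook_content p' q' k" if "k \<in> {1..n}" for k
    using that by (auto simp: hook_weight_def fun_eq_iff restrict_def split: if_splits)
  from this[of p] this[of q] pq show "p = p' \<and> q = q'"
    by (auto simp: increasing_pairs_def hook_content_def of_bool_def split: if_splits)
qed

lemma weights_hook_sum:
  assumes "6 < n"
  shows "{a \<in> weights n. (\<Sum>k=1..n. a k) = real n * (real n - 5) / 2} = hook_weight n ` increasing_pairs {2..n}"
proof (intro equalityI subsetI)
  fix a assume a: "a \<in> {a \<in> weights n. (\<Sum>k=1..n. a k) = real n * (real n - 5) / 2}"
  then interpret content_seq n a using assms by (intro weights_content_seq) auto
  show "a \<in> hook_weight n ` increasing_pairs {2..n}"
  proof (cases rule: content_sum_cases[OF assms])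
    case (2 p q)
    then have "a = hook_weight n (p, q)"
      using a by (auto simp: hook_weight_def weights_def intro!: extensionalityI[of _ "{1..n}"])
    then show ?thesis using 2 by (intro image_eqI[of _ _ "(p, q)"]) (auto simp: increasing_pairs_def)
  qed (use a assms in \<open>auto simp: field_simps\<close>)
next
  fix a assume "a \<in> hook_weight n ` increasing_pairs {2..n}"
  then obtain p q where pq: "a = hook_weight n (p, q)" "2 \<le> p" "p < q" "q \<le> n"
    by (auto simp: increasing_pairs_def)
  have "0 < dim (weight_space n (hook_content p q))"
    using dim_hook_weight_space[OF pq(2-4)] assms by simp
  then have "a \<in> weights n"
    unfolding dim_weight_space_pos_iff pq(1) hook_weight_def using restrict_in_weights by auto
  then show "a \<in> {a \<in> weights n. (\<Sum>k=1..n. a k) = real n * (real n - 5) / 2}"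
    using sum_hook_content[OF pq(2-4)] by (simp add: pq(1) hook_weight_def)
qed

lemma hook_sum_in_weight_sums:
  assumes "6 < n"
  shows "real n * (real n - 5) / 2 \<in> weight_sums n"
proof -
  have "(2, 3) \<in> increasing_pairs {2..n}" using assms by (simp add: increasing_pairs_def)
  then have "hook_weight n (2, 3) \<in> {a \<in> weights n. (\<Sum>k=1..n. a k) = real n * (real n - 5) / 2}"
    unfolding weights_hook_sum[OF assms] by (rule imageI)
  then show ?thesis
    unfolding weight_sums_def by (intro image_eqI[of _ _ "hook_weight n (2, 3)"]) auto
qed

lemma weight_sums_above_hook_sum:
  assumes "6 < n"
  shows "{\<theta> \<in> weight_sums n. real n * (real n - 5) / 2 < \<theta>}
    = {real n * (real n - 1) / 2, real n * (real n - 3) / 2, (real n - 1) * (real n - 4) / 2}" (is "?A = ?B")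
proof
  have "(\<Sum>k=1..n. a k) \<in> ?B" if "a \<in> weights n" "real n * (real n - 5) / 2 < (\<Sum>k=1..n. a k)" for a
  proof -
    interpret content_seq n a using assms that(1) by (intro weights_content_seq) auto
    show ?thesis using that(2) by (cases rule: content_sum_cases[OF assms]) auto
  qed
  then show "?A \<subseteq> ?B" unfolding weight_sums_def by blast
  show "?B \<subseteq> ?A"
    using row_sum_in_weight_sums[of n] near_row_sum_in_weight_sums[of n]
      second_row_sum_in_weight_sums[of n] assms
    by (auto simp: field_simps)
qed

lemma sum_dim_hook_weight_space:
  "(\<Sum>a\<in>hook_weight n ` increasing_pairs {2..n}. dim (weight_space n a)) = ((n - 1) choose 2)\<^sup>2"
proof -
  have "(\<Sum>a\<in>hook_weight n ` increasing_pairs {2..n}. dim (weight_space n a))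
      = (\<Sum>i\<in>increasing_pairs {2..n}. (n - 1) choose 2)"
    unfolding sum.reindex[OF inj_on_hook_weight]
    by (intro sum.cong) (auto simp: increasing_pairs_def hook_weight_space dim_hook_weight_space)
  then show ?thesis by (simp add: card_increasing_pairs power2_eq_square)
qed

theorem theorem5:
  fixes n :: nat and vs :: "(nat \<Rightarrow> nat) list"
  assumes "n > 6"
    and "vertex_enumeration (transposition_graph n) vs"
  shows "is_kth_largest 4
           {\<theta>. eigenvalue (adjacency_matrix (transposition_graph n) vs) \<theta>}
           (real n * (real n - 5) / 2)
       \<and> real (eigenvalue_multiplicity (adjacency_matrix (transposition_graph n) vs)
                (real n * (real n - 5) / 2))
         = ((real n - 1) * (real n - 2) / 2)\<^sup>2"
proof
  let ?A = "adjacency_matrix (transposition_graph n) vs" and ?t = "real n * (real n - 5) / 2"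
  note spectrum = transposition_graph_spectrum[OF assms(2)]
  have "?t \<in> weight_sums n" by (rule hook_sum_in_weight_sums[OF assms(1)])
  moreover have "card {\<theta> \<in> weight_sums n. ?t < \<theta>} = 3" "finite {\<theta> \<in> weight_sums n. ?t < \<theta>}"
    unfolding weight_sums_above_hook_sum[OF assms(1)] using assms(1) by (simp_all add: field_simps)
  ultimately show "is_kth_largest 4 {\<theta>. eigenvalue ?A \<theta>} ?t"
    unfolding is_kth_largest_def spectrum(1) Collect_mem_eq by simp
  have "real (m choose 2) = real m * (real m - 1) / 2" for m
    by (induction m) (auto simp: numeral_2_eq_2 field_simps)
  moreover have "eigenvalue_multiplicity ?A ?t = ((n - 1) choose 2)\<^sup>2"
    by (simp only: spectrum(2) weights_hook_sum[OF assms(1)] sum_dim_hook_weight_space)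
  ultimately show "real (eigenvalue_multiplicity ?A ?t) = ((real n - 1) * (real n - 2) / 2)\<^sup>2"
    using assms(1) by simp
qed

end
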